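(* In the Poisson multigraph model on $[n]$, $n\ge2$, let $W_k=\sum_{i=1}^k w(T_i)$ be the total cost of the first $k$ spanning trees. Then for every $k\ge1$, $$k^2\,\frac{n-1}{n}\le\mathbb E\,W_k\le k(k+1)\,\frac{n-1}{n}<k^2+k.$$
   Context: Poisson multigraph model: for each unordered pair $\{i,j\}$ of distinct vertices of $[n]$ there are infinitely many parallel edges whose costs are the points of an intensity-1 Poisson process on $(0,\infty)$, independent over pairs. $T_1$ is the minimum-cost spanning tree; for $k\ge2$, $T_k$ is the minimum-cost spanning tree of the multigraph with the edges of $T_1,\dots,T_{k-1}$ deleted. $w(T)$ is the total cost of the edges of $T$. *)

theory Defs
  imports "HOL-Probability.Probability"
begin

text \<open>Poisson multigraph on vertex set {0..<n}. An edge is a triple (i,j,m) with i < j < n;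
  m numbers the parallel edges of the pair {i,j}. The costs of the parallel edges of a pair are
  the points of a rate-1 Poisson process on (0,oo), represented as partial sums of i.i.d.
  Exp(1) inter-arrival times: omega (i,j,l) is the l-th inter-arrival time, and the cost of
  edge (i,j,m) is the sum of omega (i,j,l) for l \<le> m.\<close>

type_synonym edge = "nat \<times> nat \<times> nat"

definition edges :: "nat \<Rightarrow> edge set" where
  "edges n = {(i, j, m). i < j \<and> j < n}"

definition poisson_multigraph :: "nat \<Rightarrow> (edge \<Rightarrow> real) measure" where
  "poisson_multigraph n = PiM (edges n) (\<lambda>_. density lborel (exponential_density 1))"

definition cost :: "(edge \<Rightarrow> real) \<Rightarrow> edge \<Rightarrow> real" where
  "cost \<omega> e = (case e of (i, j, m) \<Rightarrow> (\<Sum>l\<le>m. \<omega> (i, j, l)))"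

text \<open>Adjacency relation on vertices induced by an edge set (undirected).\<close>
definition adj :: "edge set \<Rightarrow> (nat \<times> nat) set" where
  "adj F = {(i, j). \<exists>m. (i, j, m) \<in> F} \<union> {(j, i). \<exists>m. (i, j, m) \<in> F}"

definition connected_on :: "nat \<Rightarrow> edge set \<Rightarrow> bool" where
  "connected_on n F \<longleftrightarrow> (\<forall>u<n. \<forall>v<n. (u, v) \<in> (adj F)\<^sup>*)"

text \<open>Acyclic (forest): no edge lies on a cycle, i.e. removing any edge disconnects its endpoints.\<close>
definition acyclic_edges :: "edge set \<Rightarrow> bool" where
  "acyclic_edges F \<longleftrightarrow> (\<forall>i j m. (i, j, m) \<in> F \<longrightarrow> (i, j) \<notin> (adj (F - {(i, j, m)}))\<^sup>*)"

text \<open>Spanning tree of the multigraph with available edge set A (vertex set {0..<n}).\<close>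
definition spanning_tree :: "nat \<Rightarrow> edge set \<Rightarrow> edge set \<Rightarrow> bool" where
  "spanning_tree n A T \<longleftrightarrow> T \<subseteq> A \<and> connected_on n T \<and> acyclic_edges T"

definition tree_cost :: "(edge \<Rightarrow> real) \<Rightarrow> edge set \<Rightarrow> real" where
  "tree_cost \<omega> T = (\<Sum>e\<in>T. cost \<omega> e)"

definition is_MST :: "nat \<Rightarrow> (edge \<Rightarrow> real) \<Rightarrow> edge set \<Rightarrow> edge set \<Rightarrow> bool" where
  "is_MST n \<omega> A T \<longleftrightarrow> spanning_tree n A T \<and>
     (\<forall>T'. spanning_tree n A T' \<longrightarrow> tree_cost \<omega> T \<le> tree_cost \<omega> T')"

text \<open>Ts 1, ..., Ts k are the successive minimum spanning trees T_1, ..., T_k.\<close>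
definition greedy_trees :: "nat \<Rightarrow> (edge \<Rightarrow> real) \<Rightarrow> nat \<Rightarrow> (nat \<Rightarrow> edge set) \<Rightarrow> bool" where
  "greedy_trees n \<omega> k Ts \<longleftrightarrow>
     (\<forall>i\<in>{1..k}. is_MST n \<omega> (edges n - (\<Union>l\<in>{1..<i}. Ts l)) (Ts i))"

text \<open>W_k = w(T_1) + ... + w(T_k). Almost surely all costs are distinct and the sequence is
  unique; on the null set of ties (or where no sequence exists) the choice is arbitrary.\<close>
definition W :: "nat \<Rightarrow> nat \<Rightarrow> (edge \<Rightarrow> real) \<Rightarrow> real" where
  "W n k \<omega> = (let Ts = (SOME Ts. greedy_trees n \<omega> k Ts) in (\<Sum>i=1..k. tree_cost \<omega> (Ts i)))"

text \<open>Expectation of W_k, taken w.r.t. the completion of the product measure (so that the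
  arbitrary choice on a null set does not matter).\<close>
definition EW :: "nat \<Rightarrow> nat \<Rightarrow> ennreal" where
  "EW n k = (\<integral>\<^sup>+ \<omega>. ennreal (W n k \<omega>) \<partial>completion (poisson_multigraph n))"

end

theory Submission
  imports Defs
begin

text \<open>Run Kruskal's algorithm for all trees simultaneously: an edge arriving at time \<open>t\<close> joins one of
  the first \<open>k\<close> trees iff its ends are not yet connected in the \<open>k\<close>-th forest.

  Upper bound. Edges of each pair arrive at rate 1, so the expected time a pair spends unconnected in the
  \<open>k\<close>-th forest is the expected number of its edges that are used by \<open>T\<^sub>1, \<dots>, T\<^sub>k\<close>; summed over all
  pairs this is \<open>k (n - 1)\<close>. On the other hand, for every root \<open>r\<close> each edge \<open>e\<close> of \<open>T\<^sub>k\<close> separates \<open>r\<close>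
  from its child end, and these two vertices are unconnected up to the time \<open>cost e\<close>; hence
  \<open>w(T\<^sub>k)\<close> is at most the total time for which pairs containing \<open>r\<close> are unconnected, and summing over \<open>r\<close>
  gives \<open>n E w(T\<^sub>k) \<le> 2 k (n - 1)\<close>.

  Lower bound. The \<open>k (n - 1)\<close> edges used cost at least \<open>k (n - 1) t - \<Sum>\<^sub>e max 0 (t - cost e)\<close> for every
  \<open>t\<close>, where the sum over all edges has mean \<open>(n choose 2) t\<^sup>2 / 2\<close>; take \<open>t = 2 k / n\<close>.\<close>

section \<open>Spanning trees\<close>

lemma sym_adj: "sym (adj F)"
  by (auto simp: sym_def adj_def)

lemma conn_sym: "(x, y) \<in> (adj F)\<^sup>* \<Longrightarrow> (y, x) \<in> (adj F)\<^sup>*"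
  using sym_rtrancl[OF sym_adj] by (rule symD)

text \<open>Companion of \<open>conn_insertE\<close>: if a path from \<open>c\<close> to
  \<open>d\<close> passes through an edge with ends \<open>a\<close>, \<open>b\<close>, while
  \<open>c\<close> and \<open>d\<close> are connected anyway, then the remaining pieces connect the
  ends of that edge.\<close>

lemma conn_square:
  "(c, a) \<in> (adj F)\<^sup>* \<Longrightarrow> (c, d) \<in> (adj F)\<^sup>* \<Longrightarrow> (b, d) \<in> (adj F)\<^sup>* \<Longrightarrow> (a, b) \<in> (adj F)\<^sup>*"
  by (rule rtrancl_trans[OF conn_sym rtrancl_trans[OF _ conn_sym]])

lemma adj_mono: "F \<subseteq> G \<Longrightarrow> adj F \<subseteq> adj G"
  by (auto simp: adj_def)

lemma conn_mono: "(x, y) \<in> (adj F)\<^sup>* \<Longrightarrow> F \<subseteq> G \<Longrightarrow> (x, y) \<in> (adj G)\<^sup>*"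
  using rtrancl_mono[OF adj_mono] by blast

lemma conn_edge: "(a, b, m) \<in> F \<Longrightarrow> (a, b) \<in> (adj F)\<^sup>*"
  by (rule r_into_rtrancl) (auto simp: adj_def)

lemma adj_insert: "adj (insert (a, b, m) F) = insert (a, b) (insert (b, a) (adj F))"
  by (auto simp: adj_def)

lemma conn_subsetI:
  assumes "\<And>a b m. (a, b, m) \<in> F \<Longrightarrow> (a, b) \<in> (adj G)\<^sup>*"
  shows "(adj F)\<^sup>* \<subseteq> (adj G)\<^sup>*"
proof -
  have "adj F \<subseteq> (adj G)\<^sup>*"
  proof safe
    fix x y assume "(x, y) \<in> adj F"
    then obtain m where "(x, y, m) \<in> F \<or> (y, x, m) \<in> F" by (auto simp: adj_def)
    then show "(x, y) \<in> (adj G)\<^sup>*" using assms conn_sym by blast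
  qed
  then show ?thesis
    using rtrancl_mono[of "adj F" "(adj G)\<^sup>*"] by simp
qed

text \<open>Repeated passages through the new edge can be cut out, so only the direction of a single
  passage matters.\<close>

lemma conn_insertE:
  assumes "(x, y) \<in> (adj (insert (a, b, m) F))\<^sup>*"
  shows "(x, y) \<in> (adj F)\<^sup>* \<or> (x, a) \<in> (adj F)\<^sup>* \<and> (b, y) \<in> (adj F)\<^sup>*
      \<or> (x, b) \<in> (adj F)\<^sup>* \<and> (a, y) \<in> (adj F)\<^sup>*"
  using assms
proof (induction rule: rtrancl_induct)
  case (step y z)
  then consider "(y, z) \<in> adj F" | "y = a" "z = b" | "y = b" "z = a"
    by (auto simp: adj_insert)
  then show ?case
  proof cases
    case 1
    then show ?thesis using step.IH by (meson rtrancl.rtrancl_into_rtrancl)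
  next
    case 2
    then show ?thesis using step.IH by (meson rtrancl.rtrancl_refl)
  next
    case 3
    then show ?thesis using step.IH by (meson rtrancl.rtrancl_refl)
  qed
qed simp

lemma edges_lessD: "(i, j, m) \<in> edges n \<Longrightarrow> i < n \<and> j < n \<and> i < j"
  by (auto simp: edges_def)

lemma spanning_tree_subset: "spanning_tree n A T \<Longrightarrow> T \<subseteq> A"
  by (simp add: spanning_tree_def)

lemma spanning_tree_conn: "spanning_tree n A T \<Longrightarrow> u < n \<Longrightarrow> v < n \<Longrightarrow> (u, v) \<in> (adj T)\<^sup>*"
  by (simp add: spanning_tree_def connected_on_def)

lemma spanning_tree_acyclic:
  "spanning_tree n A T \<Longrightarrow> (i, j, m) \<in> T \<Longrightarrow> (i, j) \<notin> (adj (T - {(i, j, m)}))\<^sup>*"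
  by (auto simp: spanning_tree_def acyclic_edges_def)

section \<open>Exchanging and orienting tree edges\<close>

text \<open>Deleting the old edge leaves two components. The new edge has its ends in different
  ones, so it rejoins them without closing a cycle.\<close>

lemma spanning_tree_exchange:
  assumes T: "spanning_tree n A T" and A: "A \<subseteq> edges n"
    and e: "(i, j, m) \<in> T" and f: "(a, b, l) \<in> A"
    and nc: "(a, b) \<notin> (adj (T - {(i, j, m)}))\<^sup>*"
  shows "spanning_tree n A (insert (a, b, l) (T - {(i, j, m)}))"
proof -
  define S where "S = T - {(i, j, m)}"
  have TS: "T = insert (i, j, m) S" using e by (auto simp: S_def)
  have nc: "(a, b) \<notin> (adj S)\<^sup>*" using nc by (simp add: S_def)
  have fS: "(a, b, l) \<notin> S" using nc conn_edge by blast
  have ab: "a < n" "b < n" using f A edges_lessD by blast+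
  have "(a, b) \<in> (adj (insert (i, j, m) S))\<^sup>*" using spanning_tree_conn[OF T ab] TS by simp
  \<comment> \<open>The path from \<open>a\<close> to \<open>b\<close> in \<open>T\<close> must use
    the deleted edge, so these vertices lie on opposite sides of it.\<close>
  then have alt: "(a, i) \<in> (adj S)\<^sup>* \<and> (j, b) \<in> (adj S)\<^sup>* \<or> (a, j) \<in> (adj S)\<^sup>* \<and> (i, b) \<in> (adj S)\<^sup>*"
    using conn_insertE nc by blast
  let ?G = "insert (a, b, l) S"
  have lift: "(x, y) \<in> (adj ?G)\<^sup>*" if "(x, y) \<in> (adj S)\<^sup>*" for x y
    using conn_mono[OF that] by blast
  have abG: "(a, b) \<in> (adj ?G)\<^sup>*" by (rule conn_edge[of _ _ l]) simp
  have ij: "(i, j) \<in> (adj ?G)\<^sup>*"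
    using alt
  proof
    assume "(a, i) \<in> (adj S)\<^sup>* \<and> (j, b) \<in> (adj S)\<^sup>*"
    then show ?thesis using conn_square[OF lift abG lift] by blast
  next
    assume "(a, j) \<in> (adj S)\<^sup>* \<and> (i, b) \<in> (adj S)\<^sup>*"
    then show ?thesis using conn_sym[OF conn_square[OF lift abG lift]] by blast
  qed
  have "(adj T)\<^sup>* \<subseteq> (adj ?G)\<^sup>*"
  proof (rule conn_subsetI)
    fix c d q assume "(c, d, q) \<in> T"
    then show "(c, d) \<in> (adj ?G)\<^sup>*"
      unfolding TS using ij by (auto intro: conn_edge)
  qed
  then have "connected_on n ?G"
    using T by (auto simp: spanning_tree_def connected_on_def)
  moreover have "acyclic_edges ?G"
    unfolding acyclic_edges_def
  proof (intro allI impI)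
    fix c d q assume g: "(c, d, q) \<in> ?G"
    show "(c, d) \<notin> (adj (?G - {(c, d, q)}))\<^sup>*"
    proof (cases "(c, d, q) = (a, b, l)")
      case True
      then have "?G - {(c, d, q)} = S" using fS by auto
      then show ?thesis using True nc by simp
    next
      case False
      then have gS: "(c, d, q) \<in> S" using g by auto
      define Q where "Q = S - {(c, d, q)}"
      have G: "?G - {(c, d, q)} = insert (a, b, l) Q" using False by (auto simp: Q_def)
      have cd: "(c, d) \<in> (adj S)\<^sup>*" using gS by (rule conn_edge)
      have QS: "(x, y) \<in> (adj S)\<^sup>*" if "(x, y) \<in> (adj Q)\<^sup>*" for x y
        using conn_mono[OF that] by (auto simp: Q_def)
      show ?thesis
      proof
        \<comment> \<open>A cycle through an old edge either misses the new edge, and then it lies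
          in \<open>T\<close>, or it uses the new edge, and then the rest of it connects
          \<open>a\<close> to \<open>b\<close> inside \<open>S\<close>.\<close>
        assume "(c, d) \<in> (adj (?G - {(c, d, q)}))\<^sup>*"
        then consider "(c, d) \<in> (adj Q)\<^sup>*" | "(c, a) \<in> (adj Q)\<^sup>*" "(b, d) \<in> (adj Q)\<^sup>*"
          | "(c, b) \<in> (adj Q)\<^sup>*" "(a, d) \<in> (adj Q)\<^sup>*"
          unfolding G using conn_insertE by blast
        then show False
        proof cases
          case 1
          have "(c, d) \<in> (adj (T - {(c, d, q)}))\<^sup>*"
            by (rule conn_mono[OF 1]) (auto simp: Q_def S_def)
          then show False
            using spanning_tree_acyclic[OF T, of c d q] gS by (auto simp: S_def)
        next
          case 2
          then have "(a, b) \<in> (adj S)\<^sup>*" by (rule conn_square[OF QS cd QS])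
          then show False using nc by simp
        next
          case 3
          then have "(b, a) \<in> (adj S)\<^sup>*" by (rule conn_square[OF QS cd QS])
          then have "(a, b) \<in> (adj S)\<^sup>*" by (rule conn_sym)
          then show False using nc by simp
        qed
      qed
    qed
  qed
  moreover have "?G \<subseteq> A" using T f by (auto simp: spanning_tree_def S_def)
  ultimately show ?thesis by (simp add: spanning_tree_def S_def)
qed

text \<open>Deleting an edge of a tree cuts exactly one endpoint of it off the root \<open>r\<close>;
  that endpoint is the child end of the edge.\<close>

lemma spanning_tree_child:
  assumes T: "spanning_tree n A T" and A: "A \<subseteq> edges n" and r: "r < n"
  obtains ch where "inj_on ch T" "ch ` T \<subseteq> {..<n} - {r}"
    "\<And>e. e \<in> T \<Longrightarrow> (r, ch e) \<notin> (adj (T - {e}))\<^sup>*"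
proof -
  \<comment> \<open>Here \<open>x\<close> is the parent end and \<open>y\<close> the child end of
    \<open>e\<close>. Adjacency is asked in every \<open>F\<close> containing \<open>e\<close>, so
    that one choice serves for a single edge as well as for a tree with another edge
    deleted.\<close>
  have "\<exists>x y. (\<forall>F. e \<in> F \<longrightarrow> (x, y) \<in> adj F) \<and> x < n \<and> y < n
     \<and> (r, x) \<in> (adj (T - {e}))\<^sup>* \<and> (r, y) \<notin> (adj (T - {e}))\<^sup>*" if eT: "e \<in> T" for e
  proof -
    obtain i j m where e: "e = (i, j, m)" by (cases e)
    have ij: "i < n" "j < n" using eT T A edges_lessD[of i j m n] unfolding e spanning_tree_def by blast+
    have *: "(i, j) \<in> adj F" "(j, i) \<in> adj F" if "e \<in> F" for F using that by (auto simp: adj_def e)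
    have n: "(i, j) \<notin> (adj (T - {e}))\<^sup>*" using spanning_tree_acyclic[OF T] eT e by blast
    then have n': "\<not> ((r, i) \<in> (adj (T - {e}))\<^sup>* \<and> (r, j) \<in> (adj (T - {e}))\<^sup>*)"
      using rtrancl_trans[OF conn_sym] by blast
    have "(r, i) \<in> (adj (insert (i, j, m) (T - {e})))\<^sup>*"
      using spanning_tree_conn[OF T r ij(1)] eT by (simp add: e insert_absorb)
    then have "(r, i) \<in> (adj (T - {e}))\<^sup>* \<or> (r, j) \<in> (adj (T - {e}))\<^sup>*"
      using conn_insertE by blast
    then show ?thesis using n' * ij by blast
  qed
  then obtain pa ch where ch: "\<And>e F. e \<in> T \<Longrightarrow> e \<in> F \<Longrightarrow> (pa e, ch e) \<in> adj F"
    "\<And>e. e \<in> T \<Longrightarrow> ch e < n"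
    "\<And>e. e \<in> T \<Longrightarrow> (r, pa e) \<in> (adj (T - {e}))\<^sup>*"
    "\<And>e. e \<in> T \<Longrightarrow> (r, ch e) \<notin> (adj (T - {e}))\<^sup>*"
    by metis
  \<comment> \<open>Let \<open>e\<close> and \<open>f\<close> share a child end. The path from
    \<open>r\<close> to \<open>pa e\<close> either avoids \<open>f\<close>, and then
    \<open>e\<close> leads on to the child without using \<open>f\<close>; or its part up to
    \<open>pa f\<close>, continued by \<open>f\<close>, reaches the child without using
    \<open>e\<close>.\<close>
  have "inj_on ch T"
  proof (rule inj_onI, rule ccontr)
    fix e f assume ef: "e \<in> T" "f \<in> T" "ch e = ch f" "e \<noteq> f"
    obtain i j m where f: "f = (i, j, m)" by (cases f)
    define F where "F = T - {e} - {f}"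
    have eF: "T - {e} = insert f F" and fF: "T - {f} = insert e F" using ef by (auto simp: F_def)
    have sub: "(x, y) \<in> (adj (T - {e}))\<^sup>*" "(x, y) \<in> (adj (T - {f}))\<^sup>*" if "(x, y) \<in> (adj F)\<^sup>*" for x y
      using conn_mono[OF that] by (auto simp: F_def)
    have pf: "{pa f, ch f} = {i, j}"
      using ch(1)[of f "{f}"] ef(2) by (auto simp: adj_def f)
    have nr: "(r, ch e) \<notin> (adj F)\<^sup>*" using ch(4)[OF ef(1)] sub by blast
    have re: "(r, pa e) \<in> (adj (insert (i, j, m) F))\<^sup>*" using ch(3)[OF ef(1)] eF f by simp
    have "(r, pa e) \<in> (adj F)\<^sup>* \<or> (r, pa f) \<in> (adj F)\<^sup>*"
      using conn_insertE[OF re] pf nr ef(3) by (auto simp: doubleton_eq_iff)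
    then show False
    proof
      assume "(r, pa e) \<in> (adj F)\<^sup>*"
      then have "(r, ch e) \<in> (adj (T - {f}))\<^sup>*"
        using ch(1)[OF ef(1), of "T - {f}"] ef sub(2) by (blast intro: rtrancl.rtrancl_into_rtrancl)
      then show False using ch(4)[OF ef(2)] ef by simp
    next
      assume "(r, pa f) \<in> (adj F)\<^sup>*"
      then have "(r, ch f) \<in> (adj (T - {e}))\<^sup>*"
        using ch(1)[OF ef(2), of "T - {e}"] ef sub(1) by (blast intro: rtrancl.rtrancl_into_rtrancl)
      then show False using ch(4)[OF ef(1)] ef by simp
    qed
  qed
  moreover have "ch ` T \<subseteq> {..<n} - {r}"
  proof (rule image_subsetI)
    fix e assume e: "e \<in> T"
    have "ch e \<noteq> r" using ch(4)[OF e] by auto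
    then show "ch e \<in> {..<n} - {r}" using ch(2)[OF e] by simp
  qed
  ultimately show ?thesis using ch(4) that by blast
qed

section \<open>Number of edges and existence of spanning trees\<close>

text \<open>With \<open>d\<close> the distance from vertex 0, every other vertex is assigned an edge
  to a vertex strictly closer to 0. The assignment is injective, because an edge can lead closer to
  0 from only one of its ends.\<close>

lemma connected_card_ge:
  assumes F: "connected_on n F" "finite F" and n: "0 < n"
  shows "n - 1 \<le> card F"
proof -
  define d where "d v = (LEAST k. (0, v) \<in> adj F ^^ k)" for v
  have dv: "(0, v) \<in> adj F ^^ d v" if "v < n" for v
  proof -
    have "(0, v) \<in> (adj F)\<^sup>*" using F n that by (auto simp: connected_on_def)
    then obtain k where "(0, v) \<in> adj F ^^ k" by (auto simp: rtrancl_power)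
    then show ?thesis unfolding d_def by (rule LeastI)
  qed
  have "\<exists>e\<in>F. \<exists>u. d u < d v \<and> (e = (u, v, snd (snd e)) \<or> e = (v, u, snd (snd e)))"
    if v: "v \<in> {1..<n}" for v
  proof -
    have "d v \<noteq> 0" using dv[of v] v by (intro notI) auto
    then obtain k where k: "d v = Suc k" by (cases "d v") auto
    then obtain u where u: "(0, u) \<in> adj F ^^ k" "(u, v) \<in> adj F"
      using dv[of v] v by auto
    have "d u \<le> k" unfolding d_def using u(1) by (rule Least_le)
    then have "d u < d v" using k by simp
    moreover obtain m where "(u, v, m) \<in> F \<or> (v, u, m) \<in> F" using u(2) by (auto simp: adj_def)
    ultimately show ?thesis by (metis snd_conv)
  qed
  then obtain g where g: "\<And>v. v \<in> {1..<n} \<Longrightarrow> g v \<in> F"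
    "\<And>v. v \<in> {1..<n} \<Longrightarrow> \<exists>u. d u < d v \<and> (g v = (u, v, snd (snd (g v))) \<or> g v = (v, u, snd (snd (g v))))"
    by metis
  have "inj_on g {1..<n}"
  proof (rule inj_onI)
    fix v w assume vw: "v \<in> {1..<n}" "w \<in> {1..<n}" "g v = g w"
    obtain u where u: "d u < d v" "g v = (u, v, snd (snd (g v))) \<or> g v = (v, u, snd (snd (g v)))"
      using g(2)[OF vw(1)] by blast
    obtain x where x: "d x < d w" "g w = (x, w, snd (snd (g w))) \<or> g w = (w, x, snd (snd (g w)))"
      using g(2)[OF vw(2)] by blast
    obtain p q s where "g w = (p, q, s)" by (cases "g w")
    then show "v = w"
      using u x unfolding vw(3) by auto
  qed
  then have "card {1..<n} \<le> card F"
    using g(1) F(2) by (intro card_inj_on_le[of g]) auto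
  then show ?thesis by simp
qed

lemma spanning_tree_finite:
  assumes "spanning_tree n A T" "A \<subseteq> edges n" "0 < n"
  shows "finite T"
proof -
  obtain ch where "inj_on ch T" "ch ` T \<subseteq> {..<n} - {0::nat}"
    using spanning_tree_child[OF assms(1,2), of 0] assms(3) by metis
  then show ?thesis by (meson finite_Diff finite_imageD finite_lessThan finite_subset)
qed

lemma spanning_tree_card:
  assumes "spanning_tree n A T" "A \<subseteq> edges n" "0 < n"
  shows "card T = n - 1"
proof (rule antisym)
  obtain ch where ch: "inj_on ch T" "ch ` T \<subseteq> {..<n} - {0::nat}"
    using spanning_tree_child[OF assms(1,2), of 0] assms(3) by metis
  then have "card T \<le> card ({..<n} - {0::nat})"
    by (intro card_inj_on_le) auto
  then show "card T \<le> n - 1" using assms(3) by simp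
  show "n - 1 \<le> card T"
    using connected_card_ge[OF _ spanning_tree_finite[OF assms] assms(3)] assms(1)
    by (simp add: spanning_tree_def)
qed

text \<open>Each pair has infinitely many parallel edges, so after finitely many deletions a star
  centred at 0 survives. A connected edge set with fewest edges is then acyclic, since an edge on a
  cycle could be dropped.\<close>

lemma spanning_tree_exists:
  assumes "n \<ge> 1" "finite (edges n - A)"
  obtains T where "spanning_tree n A T"
proof -
  have "\<exists>m. (0, j, m) \<in> A" if j: "j \<in> {1..<n}" for j
  proof (rule ccontr)
    assume "\<nexists>m. (0, j, m) \<in> A"
    then have "range (\<lambda>m. (0, j, m)) \<subseteq> edges n - A"
      using j by (auto simp: edges_def)
    then have "finite (range (\<lambda>m::nat. (0::nat, j, m)))" using assms(2) finite_subset by blast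
    then have "finite (UNIV::nat set)" by (rule finite_imageD) (auto simp: inj_on_def)
    then show False by simp
  qed
  then obtain g where g: "\<And>j. j \<in> {1..<n} \<Longrightarrow> (0, j, g j) \<in> A" by metis
  define F0 where "F0 = (\<lambda>j. (0::nat, j, g j)) ` {1..<n}"
  have c0: "(0, v) \<in> (adj F0)\<^sup>*" if "v < n" for v
  proof (cases "v = 0")
    case False
    then have "(0, v, g v) \<in> F0" using that by (auto simp: F0_def)
    then show ?thesis by (rule conn_edge)
  qed simp
  have "(u, v) \<in> (adj F0)\<^sup>*" if "u < n" "v < n" for u v
    using rtrancl_trans[OF conn_sym[OF c0] c0] that by blast
  then have F0: "finite F0" "F0 \<subseteq> A" "connected_on n F0"
    using g by (simp_all add: connected_on_def) (auto simp: F0_def)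
  let ?P = "\<lambda>F. finite F \<and> F \<subseteq> A \<and> connected_on n F"
  obtain T where T: "?P T" and min: "\<And>F. ?P F \<Longrightarrow> card T \<le> card F"
    using ex_has_least_nat[of ?P F0 card] F0 by blast
  have "acyclic_edges T"
    unfolding acyclic_edges_def
  proof (intro allI impI notI)
    fix i j m assume e: "(i, j, m) \<in> T" and c: "(i, j) \<in> (adj (T - {(i, j, m)}))\<^sup>*"
    have "(adj T)\<^sup>* \<subseteq> (adj (T - {(i, j, m)}))\<^sup>*"
    proof (rule conn_subsetI)
      fix a b l assume "(a, b, l) \<in> T"
      then show "(a, b) \<in> (adj (T - {(i, j, m)}))\<^sup>*"
        using c by (cases "(a, b, l) = (i, j, m)") (auto intro: conn_edge)
    qed
    then have "?P (T - {(i, j, m)})" using T by (auto simp: connected_on_def)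
    then have "card T \<le> card (T - {(i, j, m)})" by (rule min)
    then show False using card_Diff1_less[of T "(i, j, m)"] T e by auto
  qed
  then show ?thesis using that T by (auto simp: spanning_tree_def)
qed

section \<open>Minimum spanning trees and Kruskal's algorithm\<close>

lemma is_MST_spanning: "is_MST n \<omega> A T \<Longrightarrow> spanning_tree n A T"
  by (simp add: is_MST_def)

lemma MST_exchange_cost:
  assumes T: "is_MST n \<omega> A T" and A: "A \<subseteq> edges n" and n: "0 < n"
    and e: "e \<in> T" and f: "(a, b, l) \<in> A" and nc: "(a, b) \<notin> (adj (T - {e}))\<^sup>*"
  shows "cost \<omega> e \<le> cost \<omega> (a, b, l)"
proof -
  obtain i j m where ee: "e = (i, j, m)" by (cases e)
  note sT = is_MST_spanning[OF T]
  have fin: "finite T" by (rule spanning_tree_finite[OF sT A n])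
  have "spanning_tree n A (insert (a, b, l) (T - {e}))"
    using spanning_tree_exchange[OF sT A] e f nc unfolding ee by blast
  then have "tree_cost \<omega> T \<le> tree_cost \<omega> (insert (a, b, l) (T - {e}))"
    using T by (simp add: is_MST_def)
  moreover have "(a, b, l) \<notin> T - {e}" using nc conn_edge[of a b l "T - {e}"] by blast
  moreover have "tree_cost \<omega> T = cost \<omega> e + tree_cost \<omega> (T - {e})"
    unfolding tree_cost_def by (rule sum.remove[OF fin e])
  ultimately show ?thesis
    using fin by (simp add: tree_cost_def)
qed

text \<open>Minimality in terms of connectivity: a cheaper available edge joining two vertices that
  \<open>T - {e}\<close> separates could replace \<open>e\<close> and lower the total cost.\<close>

lemma MST_cheaper_conn:
  assumes T: "is_MST n \<omega> A T" and A: "A \<subseteq> edges n" and n: "0 < n" and e: "e \<in> T"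
  shows "(adj {f \<in> A. cost \<omega> f < cost \<omega> e})\<^sup>* \<subseteq> (adj (T - {e}))\<^sup>*"
proof (rule conn_subsetI)
  fix a b l assume "(a, b, l) \<in> {f \<in> A. cost \<omega> f < cost \<omega> e}"
  then have "(a, b, l) \<in> A" "\<not> cost \<omega> e \<le> cost \<omega> (a, b, l)" by auto
  then show "(a, b) \<in> (adj (T - {e}))\<^sup>*"
    using MST_exchange_cost[OF T A n e, of a b l] by blast
qed

text \<open>The path between two vertices of a tree is unique, so if no single edge of
  \<open>S\<close> lies on it, it survives the deletion of all of \<open>S\<close> at once.\<close>

lemma spanning_tree_conn_Diff:
  assumes T: "spanning_tree n A T" and "finite S" "S \<subseteq> T"
    and "(x, y) \<in> (adj T)\<^sup>*" and "\<And>f. f \<in> S \<Longrightarrow> (x, y) \<in> (adj (T - {f}))\<^sup>*"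
  shows "(x, y) \<in> (adj (T - S))\<^sup>*"
  using assms(2-)
proof (induction S rule: finite_induct)
  case (insert f S)
  obtain i j m where f: "f = (i, j, m)" by (cases f)
  define F where "F = T - insert f S"
  have "(x, y) \<in> (adj (T - S))\<^sup>*" using insert.prems by (intro insert.IH) auto
  moreover have "T - S = insert (i, j, m) F" using insert.hyps insert.prems f by (auto simp: F_def)
  ultimately have xy: "(x, y) \<in> (adj (insert (i, j, m) F))\<^sup>*" by simp
  have lift: "(u, v) \<in> (adj (T - {f}))\<^sup>*" if "(u, v) \<in> (adj F)\<^sup>*" for u v
    by (rule conn_mono[OF that]) (auto simp: F_def)
  have xyf: "(x, y) \<in> (adj (T - {f}))\<^sup>*" using insert.prems(3) by blast
  have nij: "(i, j) \<notin> (adj (T - {f}))\<^sup>*"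
    using spanning_tree_acyclic[OF T] insert.prems(1) f by blast
  have "\<not> ((x, i) \<in> (adj F)\<^sup>* \<and> (j, y) \<in> (adj F)\<^sup>*)"
    using conn_square[OF lift xyf lift] nij by blast
  moreover have "\<not> ((x, j) \<in> (adj F)\<^sup>* \<and> (i, y) \<in> (adj F)\<^sup>*)"
    using conn_sym[OF conn_square[OF lift xyf lift]] nij by blast
  ultimately show ?case using conn_insertE[OF xy] unfolding F_def by blast
qed simp

text \<open>The minimum spanning tree consists of the edges that Kruskal's algorithm accepts. The
  right-hand side is written as all edges minus the rejected ones, to match the recursion for
  \<open>residual\<close>.\<close>

lemma MST_eq_Kruskal:
  assumes T: "is_MST n \<omega> A T" and A: "A \<subseteq> edges n" and n: "0 < n" and inj: "inj_on (cost \<omega>) A"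
  shows "T = A - {e \<in> A. (fst e, fst (snd e)) \<in> (adj {f \<in> A. cost \<omega> f < cost \<omega> e})\<^sup>*}"
proof (intro equalityI subsetI)
  note sT = is_MST_spanning[OF T]
  fix e assume e: "e \<in> T"
  obtain i j m where ee: "e = (i, j, m)" by (cases e)
  have "(i, j) \<notin> (adj (T - {e}))\<^sup>*" using spanning_tree_acyclic[OF sT] e ee by blast
  then have "(i, j) \<notin> (adj {f \<in> A. cost \<omega> f < cost \<omega> e})\<^sup>*"
    using MST_cheaper_conn[OF T A n e] by blast
  then show "e \<in> A - {e \<in> A. (fst e, fst (snd e)) \<in> (adj {f \<in> A. cost \<omega> f < cost \<omega> e})\<^sup>*}"
    using spanning_tree_subset[OF sT] e ee by auto
next
  note sT = is_MST_spanning[OF T]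
  fix e assume e: "e \<in> A - {e \<in> A. (fst e, fst (snd e)) \<in> (adj {f \<in> A. cost \<omega> f < cost \<omega> e})\<^sup>*}"
  obtain i j m where ee: "e = (i, j, m)" by (cases e)
  have ij: "i < n" "j < n" using e A ee edges_lessD[of i j m n] by auto
  show "e \<in> T"
  proof (rule ccontr)
    assume eT: "e \<notin> T"
    \<comment> \<open>By the exchange inequality no edge of \<open>T\<close> costlier than
      \<open>e\<close> separates \<open>i\<close> from \<open>j\<close>. So the tree path between
      them uses edges of cost at most that of \<open>e\<close>, which are strictly cheaper because
      there are no ties.\<close>
    define S where "S = {f \<in> T. cost \<omega> e < cost \<omega> f}"
    have "(i, j) \<in> (adj (T - S))\<^sup>*"
    proof (rule spanning_tree_conn_Diff[OF sT])
      show "finite S" using spanning_tree_finite[OF sT A n] by (simp add: S_def)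
      show "(i, j) \<in> (adj T)\<^sup>*" by (rule spanning_tree_conn[OF sT ij])
      fix f assume "f \<in> S"
      then have "f \<in> T" "\<not> cost \<omega> f \<le> cost \<omega> (i, j, m)" by (auto simp: S_def ee)
      then show "(i, j) \<in> (adj (T - {f}))\<^sup>*"
        using MST_exchange_cost[OF T A n, of f i j m] e unfolding ee by blast
    qed (auto simp: S_def)
    moreover have "T - S \<subseteq> {f \<in> A. cost \<omega> f < cost \<omega> e}"
    proof
      fix f assume f: "f \<in> T - S"
      then have fA: "f \<in> A" using spanning_tree_subset[OF sT] by blast
      moreover have "cost \<omega> f \<noteq> cost \<omega> e"
        using f eT e fA inj by (auto dest: inj_onD)
      ultimately show "f \<in> {f \<in> A. cost \<omega> f < cost \<omega> e}" using f by (auto simp: S_def)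
    qed
    ultimately have "(i, j) \<in> (adj {f \<in> A. cost \<omega> f < cost \<omega> e})\<^sup>*" by (rule conn_mono)
    then show False using e unfolding ee by simp
  qed
qed

section \<open>Generic costs and successive minimum spanning trees\<close>

text \<open>The event of full measure on which all combinatorial arguments run: local finiteness
  makes minima exist, absence of ties makes them unique, and positive gaps make costs positive and
  increasing along each pair.\<close>

definition generic :: "nat \<Rightarrow> (edge \<Rightarrow> real) \<Rightarrow> bool" where
  "generic n \<omega> \<longleftrightarrow> (\<forall>e\<in>edges n. 0 < \<omega> e) \<and> inj_on (cost \<omega>) (edges n) \<and>
     (\<forall>c. finite {e \<in> edges n. cost \<omega> e \<le> c})"

lemma cost_triple: "cost \<omega> (i, j, m) = (\<Sum>l\<le>m. \<omega> (i, j, l))"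
  by (simp add: cost_def)

lemma generic_cost_pos: "generic n \<omega> \<Longrightarrow> e \<in> edges n \<Longrightarrow> 0 < cost \<omega> e"
  by (cases e) (auto simp: generic_def cost_triple edges_def intro!: sum_pos)

text \<open>There are infinitely many spanning trees, but those no costlier than a fixed
  \<open>T0\<close> use only edges of cost at most \<open>c\<close>. Local finiteness leaves
  finitely many of them to minimise over.\<close>

lemma MST_exists:
  assumes g: "generic n \<omega>" and n: "0 < n" and A: "A \<subseteq> edges n" "finite (edges n - A)"
  obtains T where "is_MST n \<omega> A T"
proof -
  obtain T0 where T0: "spanning_tree n A T0" using spanning_tree_exists[of n A] n A(2) by auto
  define c where "c = tree_cost \<omega> T0"
  define X where "X = {T. spanning_tree n A T \<and> tree_cost \<omega> T \<le> c}"
  have "X \<subseteq> Pow {e \<in> edges n. cost \<omega> e \<le> c}"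
  proof safe
    fix T i j m assume T: "T \<in> X" and e: "(i, j, m) \<in> T"
    have sT: "spanning_tree n A T" using T by (simp add: X_def)
    have sub: "T \<subseteq> edges n" using spanning_tree_subset[OF sT] A by blast
    then show "(i, j, m) \<in> edges n" using e by blast
    have "cost \<omega> (i, j, m) \<le> tree_cost \<omega> T"
      unfolding tree_cost_def
    proof (rule member_le_sum[OF e _ spanning_tree_finite[OF sT A(1) n]])
      show "0 \<le> cost \<omega> f" if "f \<in> T - {(i, j, m)}" for f
        using generic_cost_pos[OF g, of f] sub that by fastforce
    qed
    then show "cost \<omega> (i, j, m) \<le> c" using T by (simp add: X_def)
  qed
  then have "finite X" using g by (auto simp: generic_def intro: finite_subset)
  moreover have "X \<noteq> {}" using T0 by (auto simp: X_def c_def)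
  ultimately obtain T where T: "T \<in> X" "\<And>S. S \<in> X \<Longrightarrow> tree_cost \<omega> T \<le> tree_cost \<omega> S"
    using ex_min_if_finite[of "tree_cost \<omega> ` X"] by (auto simp: not_less)
  have "tree_cost \<omega> T \<le> tree_cost \<omega> S" if "spanning_tree n A S" for S
    using T that by (cases "tree_cost \<omega> S \<le> c") (auto simp: X_def)
  then show ?thesis using that T by (auto simp: X_def is_MST_def)
qed

text \<open>The edges left over after \<open>k\<close> rounds of Kruskal's algorithm. Membership depends on the costs
  only through comparisons, so unlike the trees themselves it is defined, and measurable,
  without any choice.\<close>

primrec residual :: "nat \<Rightarrow> (edge \<Rightarrow> real) \<Rightarrow> nat \<Rightarrow> edge set" where
  "residual n \<omega> 0 = edges n"
| "residual n \<omega> (Suc k) = {e \<in> residual n \<omega> k.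
     (fst e, fst (snd e)) \<in> (adj {f \<in> residual n \<omega> k. cost \<omega> f < cost \<omega> e})\<^sup>*}"

lemma residual_subset_edges: "residual n \<omega> k \<subseteq> edges n"
  by (induction k) auto

lemma residual_antimono: "i \<le> k \<Longrightarrow> residual n \<omega> k \<subseteq> residual n \<omega> i"
  by (induction k) (auto simp: le_Suc_eq)

text \<open>Kruskal's algorithm does not look ahead.\<close>

lemma residual_cong_below:
  assumes "{f \<in> edges n. cost \<omega> f < t} = {f \<in> edges n. cost \<omega>' f < t}"
    and "\<And>f. f \<in> edges n \<Longrightarrow> cost \<omega> f < t \<Longrightarrow> cost \<omega> f = cost \<omega>' f"
  shows "{f \<in> residual n \<omega> k. cost \<omega> f < t} = {f \<in> residual n \<omega>' k. cost \<omega>' f < t}"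
proof (induction k)
  case 0
  then show ?case using assms by simp
next
  case (Suc k)
  have sub: "residual n \<omega> k \<subseteq> edges n" "residual n \<omega>' k \<subseteq> edges n"
    by (rule residual_subset_edges)+
  have iff: "f \<in> residual n \<omega> k \<and> cost \<omega> f < t \<longleftrightarrow> f \<in> residual n \<omega>' k \<and> cost \<omega>' f < t" for f
    using Suc by blast
  have eq: "cost \<omega>' f = cost \<omega> f" if "f \<in> edges n" "cost \<omega> f < t \<or> cost \<omega>' f < t" for f
  proof -
    have "cost \<omega> f < t" using that assms(1) by blast
    then show ?thesis using assms(2)[OF that(1)] by simp
  qed
  have *: "{f \<in> residual n \<omega> k. cost \<omega> f < cost \<omega> e} = {f \<in> residual n \<omega>' k. cost \<omega>' f < cost \<omega>' e}"
    if e: "e \<in> edges n" "cost \<omega> e < t" for e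
  proof (intro equalityI subsetI)
    have ee: "cost \<omega>' e = cost \<omega> e" using eq e by blast
    fix f
    {
      assume "f \<in> {f \<in> residual n \<omega> k. cost \<omega> f < cost \<omega> e}"
      then have f: "f \<in> residual n \<omega> k" "cost \<omega> f < cost \<omega> e" "cost \<omega> f < t" using e(2) by auto
      then have "cost \<omega>' f = cost \<omega> f" using eq sub by blast
      then show "f \<in> {f \<in> residual n \<omega>' k. cost \<omega>' f < cost \<omega>' e}"
        using f iff[of f] ee by simp
    next
      assume "f \<in> {f \<in> residual n \<omega>' k. cost \<omega>' f < cost \<omega>' e}"
      then have f: "f \<in> residual n \<omega>' k" "cost \<omega>' f < cost \<omega> e" "cost \<omega>' f < t" using e(2) ee by auto
      then have "cost \<omega>' f = cost \<omega> f" using eq sub by blast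
      then show "f \<in> {f \<in> residual n \<omega> k. cost \<omega> f < cost \<omega> e}"
        using f iff[of f] by simp
    }
  qed
  have "e \<in> residual n \<omega> (Suc k) \<and> cost \<omega> e < t \<longleftrightarrow> e \<in> residual n \<omega>' (Suc k) \<and> cost \<omega>' e < t" for e
  proof (cases "e \<in> residual n \<omega> k \<and> cost \<omega> e < t")
    case True
    then have "e \<in> edges n" "cost \<omega> e < t" using sub by blast+
    then show ?thesis using True iff[of e] * by simp
  next
    case False
    then show ?thesis using iff[of e] by auto
  qed
  then show ?case by blast
qed

text \<open>The two claims support each other: as long as only finitely many edges are gone a
  minimum spanning tree exists, and since it is finite, the next round again starts with finitely
  many edges gone.\<close>

lemma residual_MST:
  assumes g: "generic n \<omega>" and n: "0 < n"
  shows "is_MST n \<omega> (residual n \<omega> k) (residual n \<omega> k - residual n \<omega> (Suc k)) \<and>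
         finite (edges n - residual n \<omega> k)"
proof -
  have *: "is_MST n \<omega> (residual n \<omega> k) (residual n \<omega> k - residual n \<omega> (Suc k))"
    if "finite (edges n - residual n \<omega> k)" for k
  proof -
    obtain T where T: "is_MST n \<omega> (residual n \<omega> k) T"
      by (rule MST_exists[OF g n residual_subset_edges \<open>finite _\<close>])
    have inj: "inj_on (cost \<omega>) (residual n \<omega> k)"
      using g inj_on_subset[OF _ residual_subset_edges] by (auto simp: generic_def)
    show ?thesis using MST_eq_Kruskal[OF T residual_subset_edges n inj] T by simp
  qed
  have "finite (edges n - residual n \<omega> k)"
  proof (induction k)
    case (Suc k)
    have "finite (residual n \<omega> k - residual n \<omega> (Suc k))"
      using spanning_tree_finite[OF is_MST_spanning[OF *[OF Suc]] residual_subset_edges n] .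
    moreover have "edges n - residual n \<omega> (Suc k) \<subseteq>
       (edges n - residual n \<omega> k) \<union> (residual n \<omega> k - residual n \<omega> (Suc k))" by blast
    ultimately show ?case using Suc by (meson finite_UnI finite_subset)
  qed simp
  then show ?thesis using * by blast
qed

lemma edges_Diff_residual:
  "edges n - residual n \<omega> i = (\<Union>l<i. residual n \<omega> l - residual n \<omega> (Suc l))"
proof (induction i)
  case (Suc i)
  have "edges n - residual n \<omega> (Suc i) = (edges n - residual n \<omega> i) \<union> (residual n \<omega> i - residual n \<omega> (Suc i))"
    using residual_subset_edges[of n \<omega> i] residual_antimono[of i "Suc i" n \<omega>] by auto
  then show ?case unfolding lessThan_Suc Suc by blast
qed simp

lemma card_edges_Diff_residual:
  assumes g: "generic n \<omega>" and n: "0 < n"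
  shows "card (edges n - residual n \<omega> k) = k * (n - 1)"
proof (induction k)
  case (Suc k)
  have "edges n - residual n \<omega> (Suc k) = (edges n - residual n \<omega> k) \<union> (residual n \<omega> k - residual n \<omega> (Suc k))"
    using residual_subset_edges[of n \<omega> k] residual_antimono[of k "Suc k" n \<omega>] by auto
  moreover have "card (residual n \<omega> k - residual n \<omega> (Suc k)) = n - 1"
    using spanning_tree_card[OF is_MST_spanning[OF conjunct1[OF residual_MST[OF g n]]] residual_subset_edges n] .
  moreover have "finite (residual n \<omega> k - residual n \<omega> (Suc k))"
    using spanning_tree_finite[OF is_MST_spanning[OF conjunct1[OF residual_MST[OF g n]]] residual_subset_edges n] .
  moreover have "(edges n - residual n \<omega> k) \<inter> (residual n \<omega> k - residual n \<omega> (Suc k)) = {}"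
    by blast
  ultimately show ?case
    using Suc residual_MST[OF g n, of k] by (simp add: card_Un_disjoint del: residual.simps)
qed simp

text \<open>By strong induction the earlier trees determine the available edges, and those determine
  the next tree. Trees are numbered from 1 and residual sets from 0, hence the shift.\<close>

lemma greedy_trees_iff_residual:
  assumes g: "generic n \<omega>" and n: "0 < n"
  shows "greedy_trees n \<omega> k Ts \<longleftrightarrow>
    (\<forall>i<k. Ts (Suc i) = residual n \<omega> i - residual n \<omega> (Suc i))" (is "?L \<longleftrightarrow> ?R")
proof -
  have inj: "inj_on (cost \<omega>) (residual n \<omega> i)" for i
    using g inj_on_subset[OF _ residual_subset_edges] by (auto simp: generic_def)
  have avail: "edges n - (\<Union>l\<in>{1..<Suc i}. Ts l) = residual n \<omega> i"
    if "\<forall>l<i. Ts (Suc l) = residual n \<omega> l - residual n \<omega> (Suc l)" for i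
  proof -
    have "{1..<Suc i} = Suc ` {..<i}"
      by (simp add: image_Suc_lessThan atLeastLessThanSuc_atLeastAtMost)
    then have "(\<Union>l\<in>{1..<Suc i}. Ts l) = (\<Union>l<i. Ts (Suc l))" by (simp only: image_image)
    also have "\<dots> = edges n - residual n \<omega> i"
      unfolding edges_Diff_residual using that by auto
    finally show ?thesis using residual_subset_edges[of n \<omega> i] by auto
  qed
  have conv: "?L \<longleftrightarrow> (\<forall>i<k. is_MST n \<omega> (edges n - (\<Union>l\<in>{1..<Suc i}. Ts l)) (Ts (Suc i)))"
  proof -
    have Suc_img: "{1..k} = Suc ` {..<k}" by (simp add: image_Suc_lessThan)
    show ?thesis
      unfolding greedy_trees_def Suc_img by blast
  qed
  show ?thesis
  proof
    assume L: ?L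
    show ?R
    proof (intro allI impI)
      fix i assume "i < k"
      then show "Ts (Suc i) = residual n \<omega> i - residual n \<omega> (Suc i)"
      proof (induction i rule: less_induct)
        case (less i)
        then have "is_MST n \<omega> (residual n \<omega> i) (Ts (Suc i))"
          using L avail[of i] unfolding conv by (metis less_trans)
        then show ?case using MST_eq_Kruskal[OF _ residual_subset_edges n inj] by simp
      qed
    qed
  next
    assume R: ?R
    show ?L unfolding conv
    proof (intro allI impI)
      fix i assume i: "i < k"
      have "edges n - (\<Union>l\<in>{1..<Suc i}. Ts l) = residual n \<omega> i" by (rule avail) (use R i in auto)
      moreover have "Ts (Suc i) = residual n \<omega> i - residual n \<omega> (Suc i)" using R i by blast
      ultimately show "is_MST n \<omega> (edges n - (\<Union>l\<in>{1..<Suc i}. Ts l)) (Ts (Suc i))"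
        using residual_MST[OF g n, of i] by argo
    qed
  qed
qed

text \<open>This eliminates the choice in \<open>W\<close>: on generic costs greedy sequences exist
  and all agree on the indices 1 to \<open>k\<close>.\<close>

lemma W_eq_residual:
  assumes g: "generic n \<omega>" and n: "0 < n"
  shows "W n k \<omega> = (\<Sum>i<k. tree_cost \<omega> (residual n \<omega> i - residual n \<omega> (Suc i)))"
proof -
  define Ts where "Ts = (SOME Ts. greedy_trees n \<omega> k Ts)"
  \<comment> \<open>At index 0 truncated subtraction yields the empty set;
    \<open>greedy_trees\<close> constrains only the indices from 1 on.\<close>
  have "greedy_trees n \<omega> k (\<lambda>i. residual n \<omega> (i - 1) - residual n \<omega> i)"
    by (simp add: greedy_trees_iff_residual[OF g n] del: residual.simps)
  then have "greedy_trees n \<omega> k Ts" unfolding Ts_def by (rule someI[of "greedy_trees n \<omega> k"])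
  then have Ts: "Ts (Suc i) = residual n \<omega> i - residual n \<omega> (Suc i)" if "i < k" for i
    using that by (simp add: greedy_trees_iff_residual[OF g n] del: residual.simps)
  have "W n k \<omega> = (\<Sum>i=1..k. tree_cost \<omega> (Ts i))"
    by (simp add: W_def Ts_def Let_def)
  also have "\<dots> = (\<Sum>i<k. tree_cost \<omega> (Ts (Suc i)))"
    by (simp add: sum.atLeast1_atMost_eq)
  finally show ?thesis using Ts by (simp del: residual.simps)
qed

section \<open>The Poisson multigraph\<close>

abbreviation exp_measure :: "real measure" where
  "exp_measure \<equiv> density lborel (exponential_density 1)"

lemma prob_space_exp_measure: "prob_space exp_measure"
  by (rule prob_space_exponential_density) simp

text \<open>At rate 1 the survival function equals the density on the half-line, which says that the
  hazard rate is 1.\<close>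

lemma exponential_tail:
  fixes x :: real
  assumes "0 \<le> x"
  shows "(\<integral>\<^sup>+y. ennreal (exponential_density 1 y) * indicator {x<..} y \<partial>lborel) = ennreal (exponential_density 1 x)"
proof -
  have "(\<integral>\<^sup>+y. ennreal (exponential_density 1 y) * indicator {x<..} y \<partial>lborel)
      = (\<integral>\<^sup>+y. ennreal (exp (- y)) * indicator {x..} y \<partial>lborel)"
    using AE_lborel_singleton[of x]
    by (intro nn_integral_cong_AE, eventually_elim)
      (use assms in \<open>auto simp: exponential_density_def indicator_def\<close>)
  also have "\<dots> = ennreal (0 - (- exp (- x)))"
  proof (rule nn_integral_FTC_atLeast)
    show "((\<lambda>x::real. - exp (- x)) \<longlongrightarrow> 0) at_top"
      using tendsto_minus[OF filterlim_compose[OF exp_at_bot filterlim_uminus_at_bot_at_top]] by simp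
    show "((\<lambda>x::real. - exp (- x)) has_real_derivative exp (- y)) (at y)" for y
      by (auto intro!: derivative_eq_intros)
  qed auto
  finally show ?thesis using assms by (simp add: exponential_density_def)
qed

lemma fun_upd_measurable_poisson:
  assumes "e \<in> edges n"
  shows "(\<lambda>(\<omega>, x). fun_upd \<omega> e x) \<in> measurable (poisson_multigraph n \<Otimes>\<^sub>M borel) (poisson_multigraph n)"
proof -
  have "(\<lambda>(\<omega>, x). fun_upd \<omega> e x) \<in> measurable (poisson_multigraph n \<Otimes>\<^sub>M exp_measure) (poisson_multigraph n)"
    using measurable_add_dim[of e "edges n" "\<lambda>_. exp_measure"] assms
    by (simp add: poisson_multigraph_def insert_absorb)
  then show ?thesis
    by (subst measurable_cong_sets[OF sets_pair_measure_cong refl]) auto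
qed

text \<open>Independence of one gap from all others, in the form of Tonelli's theorem for the
  product with that coordinate split off.\<close>

lemma nn_integral_poisson_coordinate:
  assumes e: "e \<in> edges n" and f: "f \<in> borel_measurable (poisson_multigraph n)"
  shows "(\<integral>\<^sup>+\<omega>. f \<omega> \<partial>poisson_multigraph n)
    = (\<integral>\<^sup>+X. \<integral>\<^sup>+x. f (X(e := x)) \<partial>exp_measure \<partial>PiM (edges n - {e}) (\<lambda>_. exp_measure))"
proof -
  let ?Q = "PiM (edges n - {e}) (\<lambda>_. exp_measure)"
  interpret M: prob_space exp_measure by (rule prob_space_exp_measure)
  interpret Q: prob_space ?Q by (intro prob_space_PiM prob_space_exp_measure)
  interpret pair_sigma_finite exp_measure ?Q ..
  have ins: "insert e (edges n) = edges n" using e by auto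
  have eq: "distr (exp_measure \<Otimes>\<^sub>M ?Q) (poisson_multigraph n) (\<lambda>(x, X). X(e := x)) = poisson_multigraph n"
    using distr_pair_PiM_eq_PiM[of "edges n - {e}" "\<lambda>_. exp_measure" e] prob_space_exp_measure
    by (simp add: poisson_multigraph_def ins)
  have "(\<lambda>(X, x). X(e := x)) \<in> measurable (?Q \<Otimes>\<^sub>M exp_measure) (poisson_multigraph n)"
    using measurable_add_dim[of e "edges n - {e}" "\<lambda>_. exp_measure"]
    by (simp add: poisson_multigraph_def ins)
  from measurable_pair_swap[OF this]
  have m: "(\<lambda>(x, X). X(e := x)) \<in> measurable (exp_measure \<Otimes>\<^sub>M ?Q) (poisson_multigraph n)"
    by (simp add: case_prod_unfold)
  have "(\<integral>\<^sup>+\<omega>. f \<omega> \<partial>poisson_multigraph n) = (\<integral>\<^sup>+z. f ((\<lambda>(x, X). X(e := x)) z) \<partial>(exp_measure \<Otimes>\<^sub>M ?Q))"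
    by (subst eq[symmetric], rule nn_integral_distr[OF m]) (use f in simp)
  also have "\<dots> = (\<integral>\<^sup>+X. \<integral>\<^sup>+x. f (X(e := x)) \<partial>exp_measure \<partial>?Q)"
    by (subst nn_integral_snd[symmetric]) (use measurable_compose[OF m f] in auto)
  finally show ?thesis .
qed

text \<open>The compensator formula: an Exp(1) clock has hazard rate 1, so the probability that it rings
  in a set determined by the other coordinates is the expected time it spends in the set before
  ringing.\<close>

lemma nn_integral_poisson_compensator:
  assumes e: "e \<in> edges n" and p: "p \<in> borel_measurable (poisson_multigraph n)"
  shows "(\<integral>\<^sup>+\<omega>. p \<omega> \<partial>poisson_multigraph n)
    = (\<integral>\<^sup>+\<omega>. \<integral>\<^sup>+x. p (fun_upd \<omega> e x) * indicator {0..<\<omega> e} x \<partial>lborel \<partial>poisson_multigraph n)"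
    and "(\<lambda>\<omega>. \<integral>\<^sup>+x. p (fun_upd \<omega> e x) * indicator {0..<\<omega> e} x \<partial>lborel) \<in> borel_measurable (poisson_multigraph n)"
proof -
  let ?Q = "PiM (edges n - {e}) (\<lambda>_. exp_measure)"
  have ins: "insert e (edges n) = edges n" using e by auto
  have pu: "(\<lambda>(\<omega>, x). p (fun_upd \<omega> e x)) \<in> borel_measurable (poisson_multigraph n \<Otimes>\<^sub>M borel)"
    using measurable_compose[OF fun_upd_measurable_poisson[OF e] p] by (simp add: case_prod_unfold)
  have coord: "(\<lambda>\<omega>. \<omega> e) \<in> borel_measurable (poisson_multigraph n)"
    using measurable_component_singleton[OF e, of "\<lambda>_. exp_measure"] by (simp add: poisson_multigraph_def)
  have ind: "(\<lambda>z. indicator {0..<fst z e} (snd z) :: ennreal) \<in> borel_measurable (poisson_multigraph n \<Otimes>\<^sub>M borel)"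
  proof -
    have [measurable]: "(\<lambda>z. fst z e) \<in> borel_measurable (poisson_multigraph n \<Otimes>\<^sub>M borel)"
      using measurable_compose[OF measurable_fst coord] .
    show ?thesis unfolding indicator_def atLeastLessThan_iff by measurable
  qed
  show m: "(\<lambda>\<omega>. \<integral>\<^sup>+x. p (fun_upd \<omega> e x) * indicator {0..<\<omega> e} x \<partial>lborel) \<in> borel_measurable (poisson_multigraph n)"
  proof (rule sigma_finite_measure.borel_measurable_nn_integral[OF sigma_finite_lborel])
    show "(\<lambda>(\<omega>, x). p (fun_upd \<omega> e x) * indicator {0..<\<omega> e} x) \<in> borel_measurable (poisson_multigraph n \<Otimes>\<^sub>M lborel)"
      using borel_measurable_times_ennreal[OF pu ind]
      by (simp add: case_prod_unfold measurable_cong_sets[OF sets_pair_measure_cong[OF refl sets_lborel] refl])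
  qed
  \<comment> \<open>The other gaps are frozen at \<open>X\<close>. The update overwrites the value
    \<open>y\<close> of gap \<open>e\<close>, so \<open>y\<close> enters only through the
    indicator.\<close>
  have inner: "(\<integral>\<^sup>+y. \<integral>\<^sup>+x. p (X(e := x)) * indicator {0..<y} x \<partial>lborel \<partial>exp_measure) = (\<integral>\<^sup>+x. p (X(e := x)) \<partial>exp_measure)"
    if X: "X \<in> space ?Q" for X
  proof -
    have "(\<lambda>x. X(e := x)) \<in> measurable exp_measure (poisson_multigraph n)"
      using measurable_compose[OF measurable_Pair1'[OF X] measurable_add_dim[of e "edges n - {e}" "\<lambda>_. exp_measure"]]
      by (simp add: poisson_multigraph_def ins)
    from measurable_compose[OF this p]
    have q[measurable]: "(\<lambda>x. p (X(e := x))) \<in> borel_measurable borel" by simp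
    have "(\<integral>\<^sup>+y. \<integral>\<^sup>+x. p (X(e := x)) * indicator {0..<y} x \<partial>lborel \<partial>exp_measure)
      = (\<integral>\<^sup>+y. \<integral>\<^sup>+x. ennreal (exponential_density 1 y) * (p (X(e := x)) * indicator {0..<y} x) \<partial>lborel \<partial>lborel)"
      unfolding indicator_def atLeastLessThan_iff
      by (subst nn_integral_density) (auto simp: nn_integral_cmult)
    also have "\<dots> = (\<integral>\<^sup>+x. \<integral>\<^sup>+y. ennreal (exponential_density 1 y) * (p (X(e := x)) * indicator {0..<y} x) \<partial>lborel \<partial>lborel)"
      unfolding indicator_def atLeastLessThan_iff
      by (rule lborel_pair.Fubini') measurable
    \<comment> \<open>After the exchange of integrals, the integral over \<open>y\<close> is the
      probability that the gap exceeds \<open>x\<close>, which is the density at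
      \<open>x\<close>.\<close>
    also have "\<dots> = (\<integral>\<^sup>+x. ennreal (exponential_density 1 x) * p (X(e := x)) \<partial>lborel)"
    proof (rule nn_integral_cong)
      fix x :: real
      show "(\<integral>\<^sup>+y. ennreal (exponential_density 1 y) * (p (X(e := x)) * indicator {0..<y} x) \<partial>lborel)
        = ennreal (exponential_density 1 x) * p (X(e := x))"
      proof (cases "0 \<le> x")
        case True
        have "(\<integral>\<^sup>+y. ennreal (exponential_density 1 y) * (p (X(e := x)) * indicator {0..<y} x) \<partial>lborel)
          = (\<integral>\<^sup>+y. (ennreal (exponential_density 1 y) * indicator {x<..} y) * p (X(e := x)) \<partial>lborel)"
          using True by (intro nn_integral_cong) (auto simp: indicator_def)
        also have "\<dots> = ennreal (exponential_density 1 x) * p (X(e := x))"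
          using exponential_tail[OF True] by (subst nn_integral_multc) auto
        finally show ?thesis .
      next
        case False
        then show ?thesis by (simp add: exponential_density_def)
      qed
    qed
    also have "\<dots> = (\<integral>\<^sup>+x. p (X(e := x)) \<partial>exp_measure)"
      by (subst nn_integral_density) auto
    finally show ?thesis .
  qed
  show "(\<integral>\<^sup>+\<omega>. p \<omega> \<partial>poisson_multigraph n)
    = (\<integral>\<^sup>+\<omega>. \<integral>\<^sup>+x. p (fun_upd \<omega> e x) * indicator {0..<\<omega> e} x \<partial>lborel \<partial>poisson_multigraph n)"
    unfolding nn_integral_poisson_coordinate[OF e m] nn_integral_poisson_coordinate[OF e p]
    by (rule nn_integral_cong) (simp add: inner)
qed

section \<open>Measurability of costs and residual sets\<close>

lemma cost_measurable:
  assumes "e \<in> edges n"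
  shows "(\<lambda>\<omega>. cost \<omega> e) \<in> borel_measurable (poisson_multigraph n)"
proof -
  obtain i j m where e: "e = (i, j, m)" by (cases e)
  have "(\<lambda>\<omega>. \<omega> (i, j, l)) \<in> borel_measurable (poisson_multigraph n)" for l
    using measurable_component_singleton[of "(i, j, l)" "edges n" "\<lambda>_. exp_measure"] assms
    by (simp add: poisson_multigraph_def edges_def e)
  then show ?thesis unfolding e cost_triple by simp
qed

text \<open>Connectivity is a countable union over path lengths and intermediate vertices.\<close>

lemma conn_measurable:
  assumes "\<And>f. Measurable.pred M (\<lambda>\<omega>. f \<in> G \<omega>)"
  shows "Measurable.pred M (\<lambda>\<omega>. (a, b) \<in> (adj (G \<omega>))\<^sup>*)"
proof -
  note [measurable] = assms
  have adj: "Measurable.pred M (\<lambda>\<omega>. (x, y) \<in> adj (G \<omega>))" for x y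
    unfolding adj_def by simp measurable
  have "Measurable.pred M (\<lambda>\<omega>. (x, y) \<in> adj (G \<omega>) ^^ k)" for k x y
  proof (induction k arbitrary: y)
    case 0
    then show ?case by simp
  next
    case (Suc k)
    note [measurable] = Suc adj
    show ?case by (simp add: relcomp_unfold)
  qed
  note [measurable] = this
  show ?thesis unfolding rtrancl_power by measurable
qed

lemma residual_measurable:
  "Measurable.pred (poisson_multigraph n) (\<lambda>\<omega>. e \<in> residual n \<omega> k)"
proof (induction k arbitrary: e)
  case (Suc k)
  show ?case
  proof (cases "e \<in> edges n")
    case True
    have "Measurable.pred (poisson_multigraph n) (\<lambda>\<omega>. f \<in> {f \<in> residual n \<omega> k. cost \<omega> f < cost \<omega> e})" for f
    proof (cases "f \<in> edges n")
      case f: True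
      note [measurable] = Suc cost_measurable[OF f] cost_measurable[OF True]
      show ?thesis by simp
    next
      case False
      then have "f \<notin> residual n \<omega> k" for \<omega> using residual_subset_edges[of n \<omega> k] by blast
      then show ?thesis by simp
    qed
    note [measurable] = conn_measurable[OF this] Suc
    show ?thesis by simp
  next
    case False
    then have "e \<notin> residual n \<omega> (Suc k)" for \<omega> using residual_subset_edges[of n \<omega> "Suc k"] by blast
    then show ?thesis by (simp del: residual.simps)
  qed
qed simp

text \<open>Costs are partial sums of gaps, so changing one gap translates all later points of the
  same pair and nothing else.\<close>

lemma cost_fun_upd:
  "cost (fun_upd \<omega> (i, j, m) x) (a, b, l) =
    (if (a, b) = (i, j) \<and> m \<le> l then cost \<omega> (a, b, l) + (x - \<omega> (i, j, m)) else cost \<omega> (a, b, l))"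
proof (cases "(a, b) = (i, j) \<and> m \<le> l")
  case True
  have "(\<Sum>q\<le>l. (fun_upd \<omega> (i, j, m) x) (i, j, q)) = (\<Sum>q\<le>l. \<omega> (i, j, q) + (if q = m then x - \<omega> (i, j, m) else 0))"
    by (intro sum.cong) auto
  also have "\<dots> = (\<Sum>q\<le>l. \<omega> (i, j, q)) + (x - \<omega> (i, j, m))"
    using True by (simp add: sum.distrib sum.delta')
  finally show ?thesis using True by (simp add: cost_triple)
next
  case False
  have "(\<Sum>q\<le>l. (fun_upd \<omega> (i, j, m) x) (a, b, q)) = (\<Sum>q\<le>l. \<omega> (a, b, q))"
    using False by (intro sum.cong) auto
  then show ?thesis using False by (auto simp: cost_triple)
qed

lemma cost_fun_upd_self:
  "cost (fun_upd \<omega> (i, j, m) x) (i, j, m) = (\<Sum>l<m. \<omega> (i, j, l)) + x"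
  by (simp add: cost_fun_upd cost_triple lessThan_Suc_atMost[symmetric])

section \<open>Points of a pair and almost sure genericity\<close>

text \<open>The successive gaps tile an initial segment of the time axis. This turns a sum over
  gaps, as the compensator formula produces it, into one integral over time.\<close>

lemma sum_nn_integral_blocks:
  fixes w :: "nat \<Rightarrow> real" and h :: "real \<Rightarrow> ennreal"
  assumes w: "\<And>m. 0 \<le> w m" and h[measurable]: "h \<in> borel_measurable borel"
  shows "(\<Sum>m<M. \<integral>\<^sup>+x. h ((\<Sum>l<m. w l) + x) * indicator {0..<w m} x \<partial>lborel)
    = (\<integral>\<^sup>+x. h x * indicator {0..<\<Sum>l<M. w l} x \<partial>lborel)"
proof (induction M)
  case (Suc M)
  define S where "S = (\<Sum>l<M. w l)"
  have S: "0 \<le> S" using w by (simp add: S_def sum_nonneg)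
  have "(\<integral>\<^sup>+x. h (S + x) * indicator {0..<w M} x \<partial>lborel) = (\<integral>\<^sup>+x. h x * indicator {S..<S + w M} x \<partial>lborel)"
    by (subst (2) nn_integral_real_affine[where t = S and c = 1])
      (auto intro!: nn_integral_cong simp: indicator_def)
  moreover have "(\<integral>\<^sup>+x. h x * indicator {0..<S} x \<partial>lborel) + (\<integral>\<^sup>+x. h x * indicator {S..<S + w M} x \<partial>lborel)
    = (\<integral>\<^sup>+x. h x * indicator {0..<S + w M} x \<partial>lborel)"
    using S w[of M]
    by (subst nn_integral_add[symmetric]) (auto intro!: nn_integral_cong simp: indicator_def)
  ultimately show ?case using Suc by (simp add: S_def)
qed simp

lemma AE_poisson_pos: "AE \<omega> in poisson_multigraph n. \<forall>e\<in>edges n. 0 < \<omega> e"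
proof -
  have "AE x in exp_measure. 0 < x"
    using AE_lborel_singleton[of "0::real"]
    by (auto simp: AE_density exponential_density_def elim!: eventually_mono)
  then have "AE \<omega> in poisson_multigraph n. 0 < \<omega> e" if "e \<in> edges n" for e
    unfolding poisson_multigraph_def using that by (intro AE_PiM_component prob_space_exp_measure) auto
  then show ?thesis by (subst AE_ball_countable) auto
qed

text \<open>One half of Campbell's formula for a rate-1 Poisson process: the compensator formula is
  applied to every gap and the blocks are glued together. Only an upper bound results, since that
  the gaps fill the whole half-line is itself derived from it in
  \<open>AE_poisson_unbounded\<close>.\<close>

lemma nn_integral_sum_cost_le:
  assumes ij: "i < j" "j < n" and G[measurable]: "G \<in> borel_measurable borel"
  shows "(\<integral>\<^sup>+\<omega>. (\<Sum>m. G (cost \<omega> (i, j, m))) \<partial>poisson_multigraph n)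
    \<le> (\<integral>\<^sup>+x. G x * indicator {0..} x \<partial>lborel)"
proof -
  have e: "(i, j, m) \<in> edges n" for m using ij by (simp add: edges_def)
  have m: "(\<lambda>\<omega>. G (cost \<omega> (i, j, m))) \<in> borel_measurable (poisson_multigraph n)" for m
    using measurable_compose[OF cost_measurable[OF e] G] .
  interpret P: prob_space "poisson_multigraph n"
    unfolding poisson_multigraph_def by (intro prob_space_PiM prob_space_exp_measure)
  have C: "(\<integral>\<^sup>+\<omega>. G (cost \<omega> (i, j, m)) \<partial>poisson_multigraph n)
      = (\<integral>\<^sup>+\<omega>. \<integral>\<^sup>+x. G ((\<Sum>l<m. \<omega> (i, j, l)) + x) * indicator {0..<\<omega> (i, j, m)} x \<partial>lborel \<partial>poisson_multigraph n)"
    "(\<lambda>\<omega>. \<integral>\<^sup>+x. G ((\<Sum>l<m. \<omega> (i, j, l)) + x) * indicator {0..<\<omega> (i, j, m)} x \<partial>lborel)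
      \<in> borel_measurable (poisson_multigraph n)" for m
    using nn_integral_poisson_compensator[OF e m, of m m] unfolding cost_fun_upd_self by auto
  have "(\<integral>\<^sup>+\<omega>. (\<Sum>m. G (cost \<omega> (i, j, m))) \<partial>poisson_multigraph n)
    = (\<Sum>m. \<integral>\<^sup>+\<omega>. G (cost \<omega> (i, j, m)) \<partial>poisson_multigraph n)"
    by (rule nn_integral_suminf[OF m])
  also have "\<dots> = (\<Sum>m. \<integral>\<^sup>+\<omega>. \<integral>\<^sup>+x. G ((\<Sum>l<m. \<omega> (i, j, l)) + x) * indicator {0..<\<omega> (i, j, m)} x \<partial>lborel \<partial>poisson_multigraph n)"
    by (simp only: C(1))
  also have "\<dots> = (\<integral>\<^sup>+\<omega>. (\<Sum>m. \<integral>\<^sup>+x. G ((\<Sum>l<m. \<omega> (i, j, l)) + x) * indicator {0..<\<omega> (i, j, m)} x \<partial>lborel) \<partial>poisson_multigraph n)"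
    by (rule nn_integral_suminf[OF C(2), symmetric])
  also have "\<dots> \<le> (\<integral>\<^sup>+\<omega>. (\<integral>\<^sup>+x. G x * indicator {0..} x \<partial>lborel) \<partial>poisson_multigraph n)"
    using AE_poisson_pos[of n]
  proof (intro nn_integral_mono_AE, eventually_elim)
    fix \<omega> :: "edge \<Rightarrow> real" assume pos: "\<forall>e\<in>edges n. 0 < \<omega> e"
    have w: "0 \<le> \<omega> (i, j, m)" for m using pos e by (simp add: less_imp_le)
    show "(\<Sum>m. \<integral>\<^sup>+x. G ((\<Sum>l<m. \<omega> (i, j, l)) + x) * indicator {0..<\<omega> (i, j, m)} x \<partial>lborel)
      \<le> (\<integral>\<^sup>+x. G x * indicator {0..} x \<partial>lborel)"
      unfolding suminf_eq_SUP sum_nn_integral_blocks[of "\<lambda>m. \<omega> (i, j, m)", OF w G]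
      by (intro SUP_least nn_integral_mono) (auto simp: indicator_def)
  qed
  also have "\<dots> = (\<integral>\<^sup>+x. G x * indicator {0..} x \<partial>lborel)"
    by (simp add: P.emeasure_space_1)
  finally show ?thesis .
qed

text \<open>The expected number of points up to \<open>N\<close> is at most \<open>N\<close>, so
  almost surely it is finite; if no cost exceeded \<open>N\<close>, the count would be
  infinite.\<close>

lemma AE_poisson_unbounded:
  assumes ij: "i < j" "j < n"
  shows "AE \<omega> in poisson_multigraph n. \<forall>N::nat. \<exists>m. real N < cost \<omega> (i, j, m)"
  unfolding AE_all_countable
proof
  fix N :: nat
  define G :: "real \<Rightarrow> ennreal" where "G = indicator {..real N}"
  have G[measurable]: "G \<in> borel_measurable borel" by (simp add: G_def)
  have e: "(i, j, m) \<in> edges n" for m using ij by (simp add: edges_def)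
  have m[measurable]: "(\<lambda>\<omega>. G (cost \<omega> (i, j, m))) \<in> borel_measurable (poisson_multigraph n)" for m
    using measurable_compose[OF cost_measurable[OF e] G] .
  have "(\<integral>\<^sup>+\<omega>. (\<Sum>m. G (cost \<omega> (i, j, m))) \<partial>poisson_multigraph n) \<le> (\<integral>\<^sup>+x. G x * indicator {0..} x \<partial>lborel)"
    by (rule nn_integral_sum_cost_le[OF ij G])
  also have "\<dots> = (\<integral>\<^sup>+x. indicator {0..real N} x \<partial>lborel)"
    by (intro nn_integral_cong) (auto simp: G_def indicator_def)
  also have "\<dots> < \<infinity>" by simp
  finally have "(\<integral>\<^sup>+\<omega>. (\<Sum>m. G (cost \<omega> (i, j, m))) \<partial>poisson_multigraph n) \<noteq> \<infinity>" by simp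
  then have "AE \<omega> in poisson_multigraph n. (\<Sum>m. G (cost \<omega> (i, j, m))) \<noteq> \<infinity>"
    by (intro nn_integral_PInf_AE) auto
  then show "AE \<omega> in poisson_multigraph n. \<exists>m. real N < cost \<omega> (i, j, m)"
  proof eventually_elim
    fix \<omega> assume fin: "(\<Sum>m. G (cost \<omega> (i, j, m))) \<noteq> \<infinity>"
    show "\<exists>m. real N < cost \<omega> (i, j, m)"
    proof (rule ccontr)
      assume "\<nexists>m. real N < cost \<omega> (i, j, m)"
      then have "G (cost \<omega> (i, j, m)) = 1" for m by (auto simp: G_def not_less)
      then have le: "of_nat M \<le> (\<Sum>m. G (cost \<omega> (i, j, m)))" for M
        using sum_le_suminf[of "\<lambda>m. G (cost \<omega> (i, j, m))" "{..<M}"] by simp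
      obtain M where "(\<Sum>m. G (cost \<omega> (i, j, m))) < of_nat M"
        using fin ennreal_Ex_less_of_nat[of "\<Sum>m. G (cost \<omega> (i, j, m))"] by (auto simp: top.not_eq_extremum)
      then show False using le[of M] by simp
    qed
  qed
qed

text \<open>The condition \<open>ne\<close> ensures that resampling gap \<open>(i, j, m)\<close>
  leaves the other cost fixed. A tie then pins the new gap to a single value, which has Lebesgue
  measure zero.\<close>

lemma AE_cost_neq:
  assumes e: "(i, j, m) \<in> edges n" and f: "(a, b, l) \<in> edges n"
    and ne: "(a, b) \<noteq> (i, j) \<or> l < m"
  shows "AE \<omega> in poisson_multigraph n. cost \<omega> (i, j, m) \<noteq> cost \<omega> (a, b, l)"
proof -
  note [measurable] = cost_measurable[OF e] cost_measurable[OF f]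
  define p :: "(edge \<Rightarrow> real) \<Rightarrow> ennreal"
    where "p \<omega> = (if cost \<omega> (i, j, m) = cost \<omega> (a, b, l) then 1 else 0)" for \<omega>
  have p[measurable]: "p \<in> borel_measurable (poisson_multigraph n)"
    unfolding p_def by measurable
  have "(\<integral>\<^sup>+\<omega>. p \<omega> \<partial>poisson_multigraph n)
    = (\<integral>\<^sup>+\<omega>. \<integral>\<^sup>+x. p (fun_upd \<omega> (i, j, m) x) * indicator {0..<\<omega> (i, j, m)} x \<partial>lborel \<partial>poisson_multigraph n)"
    by (rule nn_integral_poisson_compensator(1)[OF e p])
  also have "\<dots> = (\<integral>\<^sup>+\<omega>. 0 \<partial>poisson_multigraph n)"
  proof (rule nn_integral_cong)
    fix \<omega>
    have "(\<integral>\<^sup>+x. p (fun_upd \<omega> (i, j, m) x) * indicator {0..<\<omega> (i, j, m)} x \<partial>lborel) = (\<integral>\<^sup>+x. 0 \<partial>(lborel :: real measure))"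
      using AE_lborel_singleton[of "cost \<omega> (a, b, l) - (\<Sum>l<m. \<omega> (i, j, l))"]
    proof (intro nn_integral_cong_AE, eventually_elim)
      fix x :: real assume "x \<noteq> cost \<omega> (a, b, l) - (\<Sum>l<m. \<omega> (i, j, l))"
      moreover have "cost (fun_upd \<omega> (i, j, m) x) (a, b, l) = cost \<omega> (a, b, l)"
        using ne by (auto simp: cost_fun_upd)
      ultimately show "p (fun_upd \<omega> (i, j, m) x) * indicator {0..<\<omega> (i, j, m)} x = 0"
        by (simp add: p_def cost_fun_upd_self)
    qed
    then show "(\<integral>\<^sup>+x. p (fun_upd \<omega> (i, j, m) x) * indicator {0..<\<omega> (i, j, m)} x \<partial>lborel) = 0" by simp
  qed
  finally have "AE \<omega> in poisson_multigraph n. p \<omega> = 0"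
    by (simp add: nn_integral_0_iff_AE)
  then show ?thesis by eventually_elim (auto simp: p_def split: if_splits)
qed

lemma AE_generic: "AE \<omega> in poisson_multigraph n. generic n \<omega>"
proof -
  have "AE \<omega> in poisson_multigraph n. e \<noteq> f \<longrightarrow> cost \<omega> e \<noteq> cost \<omega> f"
    if ef: "e \<in> edges n" "f \<in> edges n" for e f
  proof -
    obtain i j m a b l where e: "e = (i, j, m)" and f: "f = (a, b, l)" by (cases e, cases f)
    show "AE \<omega> in poisson_multigraph n. e \<noteq> f \<longrightarrow> cost \<omega> e \<noteq> cost \<omega> f"
    proof (cases "e = f")
      case False
      \<comment> \<open>For parallel edges the last gap of the later edge is the one to resample, so
        the two edges may have to change roles.\<close>
      then consider "(a, b) \<noteq> (i, j) \<or> l < m" | "(i, j) \<noteq> (a, b) \<or> m < l" using e f by force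
      then show ?thesis
      proof cases
        case 1
        from AE_cost_neq[OF ef[unfolded e f] 1] show ?thesis by (simp add: e f)
      next
        case 2
        from AE_cost_neq[OF ef(2,1)[unfolded e f] 2] show ?thesis
          by eventually_elim (simp add: e f)
      qed
    qed simp
  qed
  then have dist: "AE \<omega> in poisson_multigraph n. \<forall>e\<in>edges n. \<forall>f\<in>edges n. e \<noteq> f \<longrightarrow> cost \<omega> e \<noteq> cost \<omega> f"
    by (simp add: AE_ball_countable del: AE_all_countable)
  have "AE \<omega> in poisson_multigraph n. i < j \<and> j < n \<longrightarrow> (\<forall>N::nat. \<exists>m. real N < cost \<omega> (i, j, m))" for i j
    using AE_poisson_unbounded[of i j n] by (cases "i < j \<and> j < n") auto
  then have unb: "AE \<omega> in poisson_multigraph n. \<forall>i j. i < j \<and> j < n \<longrightarrow> (\<forall>N::nat. \<exists>m. real N < cost \<omega> (i, j, m))"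
    by (subst AE_all_countable, intro allI, subst AE_all_countable, intro allI)
  from dist unb AE_poisson_pos[of n] show ?thesis
  proof eventually_elim
    case (elim \<omega>)
    note dist = elim(1) and unb = elim(2) and pos = elim(3)
    have "finite {e \<in> edges n. cost \<omega> e \<le> c}" for c
    proof -
      obtain N :: nat where N: "c \<le> real N" using real_arch_simple by blast
      have "\<forall>i j. \<exists>m. i < j \<and> j < n \<longrightarrow> real N < cost \<omega> (i, j, m)" using unb by blast
      then obtain K where K: "\<And>i j. i < j \<Longrightarrow> j < n \<Longrightarrow> real N < cost \<omega> (i, j, K i j)" by metis
      \<comment> \<open>Costs increase along each pair, so once the edge with index
        \<open>K i j\<close> costs more than \<open>N\<close>, only smaller indices can cost at most
        \<open>c\<close>.\<close>
      have "{e \<in> edges n. cost \<omega> e \<le> c} \<subseteq> (SIGMA i:{..<n}. SIGMA j:{..<n}. {..<K i j})"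
      proof
        fix f assume f: "f \<in> {e \<in> edges n. cost \<omega> e \<le> c}"
        obtain i j m where fe: "f = (i, j, m)" by (cases f)
        have e: "(i, j, m) \<in> edges n" "cost \<omega> (i, j, m) \<le> c" using f fe by auto
        then have ij: "i < j" "j < n" by (auto simp: edges_def)
        have "m \<in> {..<K i j}"
        proof (rule ccontr)
          assume "m \<notin> {..<K i j}"
          then have "cost \<omega> (i, j, K i j) \<le> cost \<omega> (i, j, m)"
            unfolding cost_triple using pos ij
            by (intro sum_mono2) (auto simp: edges_def intro: less_imp_le)
          then show False using K[OF ij] e N by simp
        qed
        then show "f \<in> (SIGMA i:{..<n}. SIGMA j:{..<n}. {..<K i j})" using ij fe by simp
      qed
      then show ?thesis by (rule finite_subset) auto
    qed
    then show "generic n \<omega>" using dist pos by (auto simp: generic_def inj_on_def)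
  qed
qed

section \<open>The upper bound\<close>

text \<open>The \<open>m\<close>-th summand for \<open>j\<close> integrates over the times within
  the \<open>m\<close>-th gap of the pair of \<open>r\<close> and \<open>j\<close>; its indicator
  asks whether the edge \<open>m\<close>, if it arrived at that time, would be used by one of the
  first \<open>k + 1\<close> trees. This happens throughout the time before
  \<open>cost \<omega> e\<close> when \<open>j\<close> is the child end of \<open>e\<close>.
  \<open>min\<close> and \<open>max\<close> put the pair in the order demanded by
  \<open>edges\<close>.\<close>

lemma tree_cost_le_root_sum:
  assumes g: "generic n \<omega>" and r: "r < n"
  shows "ennreal (tree_cost \<omega> (residual n \<omega> k - residual n \<omega> (Suc k)))
    \<le> (\<Sum>j\<in>{..<n} - {r}. \<Sum>m. \<integral>\<^sup>+x. indicator {\<omega>. (min r j, max r j, m) \<notin> residual n \<omega> (Suc k)}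
          (fun_upd \<omega> (min r j, max r j, m) x) * indicator {0..<\<omega> (min r j, max r j, m)} x \<partial>lborel)"
    (is "_ \<le> (\<Sum>j\<in>_. ?Q j)")
proof -
  define T where "T = residual n \<omega> k - residual n \<omega> (Suc k)"
  have n: "0 < n" using r by simp
  have T: "is_MST n \<omega> (residual n \<omega> k) T" using residual_MST[OF g n] by (simp add: T_def)
  note sT = is_MST_spanning[OF T]
  note A = residual_subset_edges[of n \<omega> k]
  obtain ch where ch: "inj_on ch T" "ch ` T \<subseteq> {..<n} - {r}"
    "\<And>e. e \<in> T \<Longrightarrow> (r, ch e) \<notin> (adj (T - {e}))\<^sup>*"
    using spanning_tree_child[OF sT A r] by blast
  have posT: "0 < cost \<omega> e" if "e \<in> T" for e
    using generic_cost_pos[OF g, of e] that A by (auto simp: T_def simp del: residual.simps)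
  have "ennreal (cost \<omega> e) \<le> ?Q (ch e)" if e: "e \<in> T" for e
  proof -
    define c where "c = cost \<omega> e"
    define i where "i = min r (ch e)"
    define j where "j = max r (ch e)"
    have "ch e \<noteq> r" "ch e < n" using ch(2) e by auto
    then have ij: "i < j" "j < n" using r by (auto simp: i_def j_def)
    have ed: "(i, j, m) \<in> edges n" for m using ij by (simp add: edges_def)
    have pos: "0 < \<omega> (i, j, m)" for m using g ed by (simp add: generic_def)
    have "(r, ch e) \<notin> (adj {f \<in> residual n \<omega> k. cost \<omega> f < c})\<^sup>*"
      using MST_cheaper_conn[OF T A n e] ch(3)[OF e] unfolding c_def by blast
    then have nc: "(i, j) \<notin> (adj {f \<in> residual n \<omega> k. cost \<omega> f < c})\<^sup>*"
      unfolding i_def j_def by (auto simp: min_def max_def dest: conn_sym)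
    \<comment> \<open>An imagined arrival at a time \<open>t\<close> below \<open>c\<close> changes
      no edge cheaper than \<open>t\<close>, and Kruskal's algorithm does not look ahead. If the
      arriving edge were rejected, its ends would already be connected before \<open>c\<close>,
      contrary to \<open>nc\<close>.\<close>
    have hit: "(i, j, m) \<notin> residual n (fun_upd \<omega> (i, j, m) x) (Suc k)"
      if x: "0 \<le> x" "x < \<omega> (i, j, m)" and lt: "(\<Sum>l<m. \<omega> (i, j, l)) + x < c" for m x
    proof
      define \<omega>' where "\<omega>' = fun_upd \<omega> (i, j, m) x"
      define t where "t = (\<Sum>l<m. \<omega> (i, j, l)) + x"
      assume "(i, j, m) \<in> residual n (fun_upd \<omega> (i, j, m) x) (Suc k)"
      then have "(i, j) \<in> (adj {f \<in> residual n \<omega>' k. cost \<omega>' f < t})\<^sup>*"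
        by (simp add: \<omega>'_def t_def cost_fun_upd_self)
      also have "{f \<in> residual n \<omega>' k. cost \<omega>' f < t} = {f \<in> residual n \<omega> k. cost \<omega> f < t}"
      proof (rule residual_cong_below[symmetric])
        have eq: "cost \<omega>' f = cost \<omega> f" if f: "f \<in> edges n" "cost \<omega> f < t \<or> cost \<omega>' f < t" for f
        proof -
          obtain a b l where ff: "f = (a, b, l)" by (cases f)
          \<comment> \<open>Parallel edges from index \<open>m\<close> on cost at least
            \<open>t\<close> both before and after the update, so they are not among the edges
            compared.\<close>
          have "\<not> ((a, b) = (i, j) \<and> m \<le> l)"
          proof
            assume ab: "(a, b) = (i, j) \<and> m \<le> l"
            have "cost \<omega> (i, j, m) \<le> cost \<omega> (i, j, l)"
              unfolding cost_triple using pos ab by (intro sum_mono2) (auto intro: less_imp_le)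
            moreover have "cost \<omega> (i, j, m) = t - x + \<omega> (i, j, m)"
              by (simp add: cost_triple t_def lessThan_Suc_atMost[symmetric])
            moreover have "cost \<omega>' f = cost \<omega> (i, j, l) + (x - \<omega> (i, j, m))"
              using ab by (simp add: \<omega>'_def ff cost_fun_upd)
            ultimately show False using f(2) x ab ff by auto
          qed
          then show ?thesis by (auto simp: \<omega>'_def ff cost_fun_upd)
        qed
        show "{f \<in> edges n. cost \<omega> f < t} = {f \<in> edges n. cost \<omega>' f < t}"
          using eq by (metis (mono_tags, lifting))
        show "cost \<omega> f = cost \<omega>' f" if "f \<in> edges n" "cost \<omega> f < t" for f
          using eq[of f] that by simp
      qed
      finally have "(i, j) \<in> (adj {f \<in> residual n \<omega> k. cost \<omega> f < c})\<^sup>*"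
        by (rule conn_mono) (use lt in \<open>auto simp: t_def\<close>)
      then show False using nc by simp
    qed
    have "finite {e \<in> edges n. cost \<omega> e \<le> c}" using g by (simp add: generic_def)
    moreover have "infinite (range (\<lambda>m::nat. (i, j, m)))"
      using finite_imageD[of "\<lambda>m::nat. (i, j, m)" UNIV] by (auto simp: inj_on_def)
    ultimately have "\<not> range (\<lambda>m. (i, j, m)) \<subseteq> {e \<in> edges n. cost \<omega> e \<le> c}"
      using finite_subset by blast
    then obtain M where "\<not> cost \<omega> (i, j, M) \<le> c" using ed by blast
    then have M: "c < cost \<omega> (i, j, M)" by simp
    have SM: "c < (\<Sum>l<Suc M. \<omega> (i, j, l))" using M by (simp only: cost_triple lessThan_Suc_atMost)
    \<comment> \<open>The gaps with indices 0 to \<open>M\<close> cover all times up to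
      \<open>c\<close>, so \<open>c\<close> can be distributed over these gaps.\<close>
    have "ennreal c = (\<integral>\<^sup>+x. indicator {..<c} x * indicator {0..<\<Sum>l<Suc M. \<omega> (i, j, l)} x \<partial>lborel)"
    proof -
      have "(\<integral>\<^sup>+x. indicator {..<c} x * indicator {0..<\<Sum>l<Suc M. \<omega> (i, j, l)} x \<partial>lborel) = (\<integral>\<^sup>+x. indicator {0..<c} x \<partial>lborel)"
        using SM by (intro nn_integral_cong) (auto simp: indicator_def)
      moreover have "0 < c" using posT[OF e] by (simp add: c_def)
      ultimately show ?thesis by simp
    qed
    also have "\<dots> = (\<Sum>m<Suc M. \<integral>\<^sup>+x. indicator {..<c} ((\<Sum>l<m. \<omega> (i, j, l)) + x) * indicator {0..<\<omega> (i, j, m)} x \<partial>lborel)"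
      by (rule sum_nn_integral_blocks[symmetric]) (auto intro: less_imp_le[OF pos])
    also have "\<dots> \<le> (\<Sum>m<Suc M. \<integral>\<^sup>+x. indicator {\<omega>. (i, j, m) \<notin> residual n \<omega> (Suc k)}
          (fun_upd \<omega> (i, j, m) x) * indicator {0..<\<omega> (i, j, m)} x \<partial>lborel)"
      using hit by (intro sum_mono nn_integral_mono) (auto simp: indicator_def simp del: residual.simps)
    also have "\<dots> \<le> ?Q (ch e)"
      unfolding i_def[symmetric] j_def[symmetric] by (intro sum_le_suminf) auto
    finally show ?thesis by (simp add: c_def)
  qed
  then have "(\<Sum>e\<in>T. ennreal (cost \<omega> e)) \<le> (\<Sum>e\<in>T. ?Q (ch e))" by (rule sum_mono)
  \<comment> \<open>Distinct tree edges have distinct child ends, so no pair containing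
    \<open>r\<close> is charged twice.\<close>
  also have "\<dots> = (\<Sum>j\<in>ch ` T. ?Q j)" by (rule sum.reindex_cong[OF ch(1) refl refl, symmetric])
  also have "\<dots> \<le> (\<Sum>j\<in>{..<n} - {r}. ?Q j)" by (rule sum_mono2[OF _ ch(2)]) auto
  finally show ?thesis
    unfolding tree_cost_def T_def[symmetric]
    using posT by (simp add: sum_ennreal less_imp_le)
qed

lemma suminf_indicator_card:
  assumes "finite {m::nat. P m}"
  shows "(\<Sum>m. indicator {m. P m} m :: ennreal) = of_nat (card {m. P m})"
proof -
  have "(\<Sum>m. indicator {m. P m} m :: ennreal) = (\<Sum>m\<in>{m. P m}. indicator {m. P m} m)"
    by (rule suminf_finite) (use assms in auto)
  then show ?thesis by simp
qed

text \<open>An edge is met once from each of its ends; \<open>swap\<close> keeps the two occurrences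
  apart as triples. This is the factor 2 in the upper bound.\<close>

lemma sum_ordered_pairs_card_le:
  fixes U :: "edge set"
  assumes "finite U"
  shows "(\<Sum>r<n. \<Sum>j\<in>{..<n} - {r}. card {m. (min r j, max r j, m) \<in> U}) \<le> 2 * card U"
proof -
  have fin: "finite {m. (a, b, m) \<in> U}" for a b
    using finite_vimageI[OF assms, of "\<lambda>m. (a, b, m)"] by (simp add: inj_def vimage_def)
  define swap :: "edge \<Rightarrow> edge" where "swap = (\<lambda>(a, b, m). (b, a, m))"
  have "(\<Sum>r<n. \<Sum>j\<in>{..<n} - {r}. card {m. (min r j, max r j, m) \<in> U})
    = card (SIGMA r:{..<n}. SIGMA j:{..<n} - {r}. {m. (min r j, max r j, m) \<in> U})"
    by (simp add: card_SigmaI fin)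
  also have "\<dots> \<le> card (U \<union> swap ` U)"
  proof (rule card_mono)
    show "finite (U \<union> swap ` U)" using assms by simp
    show "(SIGMA r:{..<n}. SIGMA j:{..<n} - {r}. {m. (min r j, max r j, m) \<in> U}) \<subseteq> U \<union> swap ` U"
      by (auto simp: swap_def image_iff min_def max_def split: if_splits)
  qed
  also have "\<dots> \<le> card U + card (swap ` U)" by (rule card_Un_le)
  also have "\<dots> \<le> 2 * card U" using card_image_le[OF assms, of swap] by simp
  finally show ?thesis .
qed

text \<open>\<open>H\<close> adds the root bounds over all \<open>n\<close> roots. It is kept as an
  explicit measurable function so that its mean can be computed term by term, with the compensator
  formula turning waiting times into counts of used edges.\<close>

lemma tree_cost_dominated:
  assumes n: "n \<ge> 2"
  obtains H where "H \<in> borel_measurable (poisson_multigraph n)"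
    "AE \<omega> in poisson_multigraph n.
       of_nat n * ennreal (tree_cost \<omega> (residual n \<omega> k - residual n \<omega> (Suc k))) \<le> H \<omega>"
    "(\<integral>\<^sup>+\<omega>. H \<omega> \<partial>poisson_multigraph n) \<le> of_nat (2 * (Suc k * (n - 1)))"
proof -
  let ?P = "poisson_multigraph n"
  let ?w = "\<lambda>\<omega>. ennreal (tree_cost \<omega> (residual n \<omega> k - residual n \<omega> (Suc k)))"
  interpret P: prob_space ?P
    unfolding poisson_multigraph_def by (intro prob_space_PiM prob_space_exp_measure)
  define I :: "edge \<Rightarrow> (edge \<Rightarrow> real) \<Rightarrow> ennreal"
    where "I e = indicator {\<omega>. e \<notin> residual n \<omega> (Suc k)}" for e
  define h where "h e \<omega> = (\<integral>\<^sup>+x. I e (fun_upd \<omega> e x) * indicator {0..<\<omega> e} x \<partial>lborel)" for e \<omega>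
  have I: "I e \<in> borel_measurable ?P" for e
  proof -
    note [measurable] = residual_measurable[where n = n and e = e and k = "Suc k"]
    show ?thesis unfolding I_def indicator_def by (simp del: residual.simps)
  qed
  have h: "h e \<in> borel_measurable ?P" "(\<integral>\<^sup>+\<omega>. h e \<omega> \<partial>?P) = (\<integral>\<^sup>+\<omega>. I e \<omega> \<partial>?P)" if "e \<in> edges n" for e
    using nn_integral_poisson_compensator[OF that I] by (simp_all add: h_def[abs_def])
  define E where "E r j m = (min r j, max r j, m)" for r j m :: nat
  have E: "E r j m \<in> edges n" if "r < n" "j \<in> {..<n} - {r}" for r j m
    using that by (auto simp: E_def edges_def)
  have mh: "(\<lambda>\<omega>. \<Sum>m. h (E r j m) \<omega>) \<in> borel_measurable ?P" if "r < n" "j \<in> {..<n} - {r}" for r j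
    using h(1)[OF E[OF that]] by measurable
  have mI: "(\<lambda>\<omega>. \<Sum>m. I (E r j m) \<omega>) \<in> borel_measurable ?P" for r j
    using I by measurable
  define H where "H \<omega> = (\<Sum>r<n. \<Sum>j\<in>{..<n} - {r}. \<Sum>m. h (E r j m) \<omega>)" for \<omega>
  have H: "H \<in> borel_measurable ?P"
    unfolding H_def[abs_def] by (intro borel_measurable_sum mh) auto
  have dom: "AE \<omega> in ?P. of_nat n * ?w \<omega> \<le> H \<omega>"
    using AE_generic[of n]
  proof eventually_elim
    case (elim \<omega>)
    have "of_nat n * ?w \<omega> = (\<Sum>r<n. ?w \<omega>)" by simp
    also have "\<dots> \<le> H \<omega>"
      unfolding H_def
    proof (rule sum_mono)
      fix r assume "r \<in> {..<n}"
      then show "?w \<omega> \<le> (\<Sum>j\<in>{..<n} - {r}. \<Sum>m. h (E r j m) \<omega>)"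
        using tree_cost_le_root_sum[OF elim, of r k]
        unfolding h_def I_def E_def by (simp del: residual.simps)
    qed
    finally show ?case .
  qed
  have "(\<integral>\<^sup>+\<omega>. H \<omega> \<partial>?P) = (\<Sum>r<n. \<integral>\<^sup>+\<omega>. (\<Sum>j\<in>{..<n} - {r}. \<Sum>m. h (E r j m) \<omega>) \<partial>?P)"
    unfolding H_def by (intro nn_integral_sum borel_measurable_sum mh) auto
  also have "\<dots> = (\<Sum>r<n. \<Sum>j\<in>{..<n} - {r}. \<integral>\<^sup>+\<omega>. (\<Sum>m. h (E r j m) \<omega>) \<partial>?P)"
    by (intro sum.cong refl nn_integral_sum mh) auto
  \<comment> \<open>The expected time during which an arrival would be used becomes the expected
    number of edges actually used.\<close>
  also have "\<dots> = (\<Sum>r<n. \<Sum>j\<in>{..<n} - {r}. \<integral>\<^sup>+\<omega>. (\<Sum>m. I (E r j m) \<omega>) \<partial>?P)"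
  proof (intro sum.cong refl)
    fix r j assume "r \<in> {..<n}" "j \<in> {..<n} - {r}"
    then have "E r j m \<in> edges n" for m using E by simp
    then show "(\<integral>\<^sup>+\<omega>. (\<Sum>m. h (E r j m) \<omega>) \<partial>?P) = (\<integral>\<^sup>+\<omega>. (\<Sum>m. I (E r j m) \<omega>) \<partial>?P)"
      by (simp add: nn_integral_suminf h I)
  qed
  also have "\<dots> = (\<Sum>r<n. \<integral>\<^sup>+\<omega>. (\<Sum>j\<in>{..<n} - {r}. \<Sum>m. I (E r j m) \<omega>) \<partial>?P)"
    by (intro sum.cong refl nn_integral_sum[symmetric] mI)
  also have "\<dots> = (\<integral>\<^sup>+\<omega>. (\<Sum>r<n. \<Sum>j\<in>{..<n} - {r}. \<Sum>m. I (E r j m) \<omega>) \<partial>?P)"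
    by (intro nn_integral_sum[symmetric] borel_measurable_sum mI)
  \<comment> \<open>On generic costs the count is deterministic: \<open>Suc k\<close> trees use
    \<open>Suc k * (n - 1)\<close> edges, each seen from both ends.\<close>
  also have "\<dots> \<le> (\<integral>\<^sup>+\<omega>. of_nat (2 * (Suc k * (n - 1))) \<partial>?P)"
    using AE_generic[of n]
  proof (intro nn_integral_mono_AE, eventually_elim)
    fix \<omega> :: "edge \<Rightarrow> real" assume g: "generic n \<omega>"
    define U where "U = edges n - residual n \<omega> (Suc k)"
    have U: "finite U" "card U = Suc k * (n - 1)"
      using residual_MST[OF g, of "Suc k"] card_edges_Diff_residual[OF g, of "Suc k"] n
      by (simp_all add: U_def del: residual.simps)
    have fin: "finite {m. (a, b, m) \<in> U}" for a b
      using finite_vimageI[OF U(1), of "\<lambda>m. (a, b, m)"] by (simp add: inj_def vimage_def)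
    have "(\<Sum>r<n. \<Sum>j\<in>{..<n} - {r}. \<Sum>m. I (E r j m) \<omega>)
      = (\<Sum>r<n. \<Sum>j\<in>{..<n} - {r}. of_nat (card {m. (min r j, max r j, m) \<in> U}))"
    proof (intro sum.cong refl)
      fix r j assume rj: "r \<in> {..<n}" "j \<in> {..<n} - {r}"
      then have "I (E r j m) \<omega> = indicator {m. (min r j, max r j, m) \<in> U} m" for m
        using E[of r j m] by (auto simp: I_def U_def E_def indicator_def simp del: residual.simps)
      then show "(\<Sum>m. I (E r j m) \<omega>) = of_nat (card {m. (min r j, max r j, m) \<in> U})"
        using suminf_indicator_card[OF fin] by simp
    qed
    also have "\<dots> = of_nat (\<Sum>r<n. \<Sum>j\<in>{..<n} - {r}. card {m. (min r j, max r j, m) \<in> U})"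
      by simp
    also have "\<dots> \<le> of_nat (2 * (Suc k * (n - 1)))"
      using sum_ordered_pairs_card_le[OF U(1), of n] unfolding U(2) by (rule of_nat_mono)
    finally show "(\<Sum>r<n. \<Sum>j\<in>{..<n} - {r}. \<Sum>m. I (E r j m) \<omega>) \<le> of_nat (2 * (Suc k * (n - 1)))" .
  qed
  also have "\<dots> = of_nat (2 * (Suc k * (n - 1)))" by (simp add: P.emeasure_space_1)
  finally show ?thesis using that[OF H dom] by simp
qed

lemma EW_le:
  assumes n: "n \<ge> 2"
  shows "EW n k \<le> ennreal (real k * (real k + 1) * (real n - 1) / real n)"
proof -
  let ?P = "poisson_multigraph n"
  let ?w = "\<lambda>i \<omega>. tree_cost \<omega> (residual n \<omega> i - residual n \<omega> (Suc i))"
  have "\<forall>i. \<exists>H. H \<in> borel_measurable ?P \<and> (AE \<omega> in ?P. of_nat n * ennreal (?w i \<omega>) \<le> H \<omega>)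
      \<and> (\<integral>\<^sup>+\<omega>. H \<omega> \<partial>?P) \<le> of_nat (2 * (Suc i * (n - 1)))"
  proof
    fix i
    show "\<exists>H. H \<in> borel_measurable ?P \<and> (AE \<omega> in ?P. of_nat n * ennreal (?w i \<omega>) \<le> H \<omega>)
      \<and> (\<integral>\<^sup>+\<omega>. H \<omega> \<partial>?P) \<le> of_nat (2 * (Suc i * (n - 1)))"
      by (rule tree_cost_dominated[OF n, of i]) blast
  qed
  then obtain H where H: "\<And>i. H i \<in> borel_measurable ?P"
    "\<And>i. AE \<omega> in ?P. of_nat n * ennreal (?w i \<omega>) \<le> H i \<omega>"
    "\<And>i. (\<integral>\<^sup>+\<omega>. H i \<omega> \<partial>?P) \<le> of_nat (2 * (Suc i * (n - 1)))"
    unfolding choice_iff by blast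
  have inv: "ennreal (1 / real n) * of_nat n = 1"
    using n by (simp add: ennreal_of_nat_eq_real_of_nat ennreal_mult[symmetric])
  have "AE \<omega> in ?P. \<forall>i. of_nat n * ennreal (?w i \<omega>) \<le> H i \<omega>"
    using H(2) by (simp add: AE_all_countable)
  then have dom: "AE \<omega> in ?P. ennreal (W n k \<omega>) \<le> (\<Sum>i<k. ennreal (1 / real n) * H i \<omega>)"
    using AE_generic[of n]
  proof eventually_elim
    case (elim \<omega>)
    have nonneg: "0 \<le> ?w i \<omega>" for i
      unfolding tree_cost_def
    proof (rule sum_nonneg)
      fix e assume "e \<in> residual n \<omega> i - residual n \<omega> (Suc i)"
      then have "e \<in> edges n" using residual_subset_edges[of n \<omega> i] by blast
      then show "0 \<le> cost \<omega> e" using generic_cost_pos[OF elim(2)] by (simp add: less_imp_le)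
    qed
    have "ennreal (W n k \<omega>) = (\<Sum>i<k. ennreal (?w i \<omega>))"
      using W_eq_residual[OF elim(2), of k] n nonneg by (simp add: sum_ennreal del: residual.simps)
    also have "\<dots> \<le> (\<Sum>i<k. ennreal (1 / real n) * H i \<omega>)"
    proof (rule sum_mono)
      fix i
      have "ennreal (?w i \<omega>) = ennreal (1 / real n) * (of_nat n * ennreal (?w i \<omega>))"
        by (simp only: mult.assoc[symmetric] inv mult_1_left)
      also have "\<dots> \<le> ennreal (1 / real n) * H i \<omega>"
        using elim(1) by (intro mult_left_mono) auto
      finally show "ennreal (?w i \<omega>) \<le> ennreal (1 / real n) * H i \<omega>" .
    qed
    finally show ?case .
  qed
  \<comment> \<open>The nonnegative integral is a supremum over simple functions below the
    integrand, and completing the measure does not change it.\<close>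
  have "EW n k = (\<integral>\<^sup>+\<omega>. ennreal (W n k \<omega>) \<partial>?P)"
    by (simp add: EW_def nn_integral_completion)
  also have "\<dots> \<le> (\<integral>\<^sup>+\<omega>. (\<Sum>i<k. ennreal (1 / real n) * H i \<omega>) \<partial>?P)"
    by (rule nn_integral_mono_AE[OF dom])
  also have "\<dots> = (\<Sum>i<k. ennreal (1 / real n) * (\<integral>\<^sup>+\<omega>. H i \<omega> \<partial>?P))"
    using H(1) by (subst nn_integral_sum) (auto simp: nn_integral_cmult)
  also have "\<dots> \<le> (\<Sum>i<k. ennreal (1 / real n) * of_nat (2 * (Suc i * (n - 1))))"
    by (intro sum_mono mult_left_mono H(3)) auto
  also have "\<dots> = (\<Sum>i<k. ennreal (2 * (real i + 1) * (real n - 1) / real n))"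
  proof (rule sum.cong[OF refl])
    fix i
    have "real (2 * (Suc i * (n - 1))) = 2 * (real i + 1) * (real n - 1)"
    proof -
      have "real (n - 1) = real n - 1" using n by (simp add: of_nat_diff)
      then show ?thesis unfolding of_nat_mult of_nat_Suc by simp
    qed
    then show "ennreal (1 / real n) * of_nat (2 * (Suc i * (n - 1))) = ennreal (2 * (real i + 1) * (real n - 1) / real n)"
      unfolding ennreal_of_nat_eq_real_of_nat using n by (simp add: ennreal_mult[symmetric])
  qed
  also have "\<dots> = ennreal (\<Sum>i<k. 2 * (real i + 1) * (real n - 1) / real n)"
    using n by (intro sum_ennreal) auto
  \<comment> \<open>Tree number \<open>i + 1\<close> contributes at most twice \<open>i + 1\<close>
    times the common factor, and these terms add up to \<open>k (k + 1)\<close> times it.\<close>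
  also have "(\<Sum>i<k. 2 * (real i + 1) * (real n - 1) / real n) = real k * (real k + 1) * (real n - 1) / real n"
    using n by (induction k) (auto simp: field_simps)
  finally show ?thesis .
qed

section \<open>The lower bound\<close>

text \<open>\<open>ennreal\<close> cuts off at zero, so the integrand is the positive part of
  \<open>t - x\<close> and the integral is the area of a right triangle with legs
  \<open>t\<close>.\<close>

lemma nn_integral_ramp:
  fixes t :: real
  assumes "0 \<le> t"
  shows "(\<integral>\<^sup>+x. ennreal (t - x) * indicator {0..} x \<partial>lborel) = ennreal (t\<^sup>2 / 2)"
proof -
  have "(\<integral>\<^sup>+x. ennreal (t - x) * indicator {0..} x \<partial>lborel) = (\<integral>\<^sup>+x. ennreal (t - x) * indicator {0..t} x \<partial>lborel)"
    by (intro nn_integral_cong) (auto simp: indicator_def ennreal_neg)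
  also have "\<dots> = ennreal ((t * t - t\<^sup>2 / 2) - (t * 0 - 0\<^sup>2 / 2))"
  proof (rule nn_integral_FTC_Icc)
    show "((\<lambda>x. t * x - x\<^sup>2 / 2) has_real_derivative t - x) (at x)" for x
      by (auto intro!: derivative_eq_intros)
  qed (use assms in auto)
  finally show ?thesis by (simp add: power2_eq_square)
qed

lemma sum_le_suminf_edges:
  fixes g :: "edge \<Rightarrow> ennreal"
  assumes U: "finite U" "U \<subseteq> edges n"
  shows "sum g U \<le> (\<Sum>j<n. \<Sum>i<j. \<Sum>m. g (i, j, m))"
proof -
  define M where "M = Suc (Max ((\<lambda>(i, j, m). m) ` U))"
  have M: "m < M" if "(i, j, m) \<in> U" for i j m
    unfolding M_def less_Suc_eq_le using U(1) that by (intro Max_ge) force+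
  have "sum g U = sum (\<lambda>(j, i, m). g (i, j, m)) ((\<lambda>(i, j, m). (j, i, m)) ` U)"
    by (subst sum.reindex) (auto simp: inj_on_def intro!: sum.cong)
  also have "\<dots> \<le> sum (\<lambda>(j, i, m). g (i, j, m)) (SIGMA j:{..<n}. SIGMA i:{..<j}. {..<M})"
    using U M by (intro sum_mono2) (auto simp: edges_def)
  also have "\<dots> = (\<Sum>j<n. \<Sum>i<j. \<Sum>m<M. g (i, j, m))"
    by (simp add: sum.Sigma[symmetric])
  also have "\<dots> \<le> (\<Sum>j<n. \<Sum>i<j. \<Sum>m. g (i, j, m))"
    by (intro sum_mono sum_le_suminf) auto
  finally show ?thesis .
qed

lemma EW_ge:
  assumes n: "n \<ge> 2"
  shows "ennreal (real k ^ 2 * (real n - 1) / real n) \<le> EW n k"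
proof -
  let ?P = "poisson_multigraph n"
  interpret P: prob_space ?P
    unfolding poisson_multigraph_def by (intro prob_space_PiM prob_space_exp_measure)
  \<comment> \<open>The threshold below which \<open>k (n - 1)\<close> edges are expected.\<close>
  define t where "t = 2 * real k / real n"
  define c where "c = real k * (real n - 1) * t"
  \<comment> \<open>The total shortfall below \<open>t\<close> runs over all edges, so its mean does
    not involve which edges the trees select.\<close>
  define Y where "Y \<omega> = (\<Sum>j<n. \<Sum>i<j. \<Sum>m. ennreal (t - cost \<omega> (i, j, m)))" for \<omega>
  have t: "0 \<le> t" by (simp add: t_def)
  have mY: "(\<lambda>\<omega>. \<Sum>m. ennreal (t - cost \<omega> (i, j, m))) \<in> borel_measurable ?P" if "i < j" "j < n" for i j
  proof -
    have [measurable]: "(\<lambda>\<omega>. cost \<omega> (i, j, m)) \<in> borel_measurable ?P" for m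
      using that by (intro cost_measurable) (simp add: edges_def)
    show ?thesis by measurable
  qed
  have Y[measurable]: "Y \<in> borel_measurable ?P"
    unfolding Y_def[abs_def] by (intro borel_measurable_sum mY) auto
  have "(\<integral>\<^sup>+\<omega>. Y \<omega> \<partial>?P) = (\<Sum>j<n. \<Sum>i<j. \<integral>\<^sup>+\<omega>. (\<Sum>m. ennreal (t - cost \<omega> (i, j, m))) \<partial>?P)"
  proof -
    have "(\<integral>\<^sup>+\<omega>. Y \<omega> \<partial>?P) = (\<Sum>j<n. \<integral>\<^sup>+\<omega>. (\<Sum>i<j. \<Sum>m. ennreal (t - cost \<omega> (i, j, m))) \<partial>?P)"
      unfolding Y_def by (intro nn_integral_sum borel_measurable_sum mY) auto
    also have "\<dots> = (\<Sum>j<n. \<Sum>i<j. \<integral>\<^sup>+\<omega>. (\<Sum>m. ennreal (t - cost \<omega> (i, j, m))) \<partial>?P)"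
      by (intro sum.cong refl nn_integral_sum mY) auto
    finally show ?thesis .
  qed
  also have "\<dots> \<le> (\<Sum>j<n. \<Sum>i<j. ennreal (t\<^sup>2 / 2))"
  proof (intro sum_mono)
    fix j i assume "j \<in> {..<n}" "i \<in> {..<j}"
    then show "(\<integral>\<^sup>+\<omega>. (\<Sum>m. ennreal (t - cost \<omega> (i, j, m))) \<partial>?P) \<le> ennreal (t\<^sup>2 / 2)"
      using nn_integral_sum_cost_le[of i j n "\<lambda>x. ennreal (t - x)"] nn_integral_ramp[OF t] by simp
  qed
  also have "\<dots> = (\<Sum>j<n. ennreal (\<Sum>i<j. t\<^sup>2 / 2))"
    by (intro sum.cong refl sum_ennreal) simp
  also have "\<dots> = ennreal (\<Sum>j<n. \<Sum>i<j. t\<^sup>2 / 2)"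
    by (intro sum_ennreal) (simp add: sum_nonneg)
  also have "(\<Sum>j<n. \<Sum>i<j. t\<^sup>2 / 2) = real n * (real n - 1) / 2 * (t\<^sup>2 / 2)"
    by (induction n) (auto simp: field_simps)
  also have "\<dots> = real k ^ 2 * (real n - 1) / real n"
    using n by (simp add: t_def field_simps power2_eq_square)
  finally have EY: "(\<integral>\<^sup>+\<omega>. Y \<omega> \<partial>?P) \<le> ennreal (real k ^ 2 * (real n - 1) / real n)" .
  \<comment> \<open>Subtraction in \<open>ennreal\<close> truncates at zero, so the bound is trivial
    wherever \<open>Y \<omega>\<close> exceeds \<open>c\<close>.\<close>
  have dom: "AE \<omega> in ?P. ennreal c - Y \<omega> \<le> ennreal (W n k \<omega>)"
    using AE_generic[of n]
  proof eventually_elim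
    case (elim \<omega>)
    define U where "U = edges n - residual n \<omega> k"
    have U: "finite U" "card U = k * (n - 1)"
      using residual_MST[OF elim, of k] card_edges_Diff_residual[OF elim, of k] n
      by (simp_all add: U_def)
    have finT: "finite (residual n \<omega> i - residual n \<omega> (Suc i))" for i
      using spanning_tree_finite[OF is_MST_spanning[OF conjunct1[OF residual_MST[OF elim]]] residual_subset_edges] n
      by simp
    have "W n k \<omega> = (\<Sum>e\<in>U. cost \<omega> e)"
    proof -
      have "(\<Sum>e\<in>U. cost \<omega> e) = (\<Sum>i<k. \<Sum>e\<in>residual n \<omega> i - residual n \<omega> (Suc i). cost \<omega> e)"
        unfolding U_def edges_Diff_residual
      proof (rule sum.UNION_disjoint)
        show "\<forall>i\<in>{..<k}. \<forall>l\<in>{..<k}. i \<noteq> l \<longrightarrow>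
          (residual n \<omega> i - residual n \<omega> (Suc i)) \<inter> (residual n \<omega> l - residual n \<omega> (Suc l)) = {}"
        proof (intro ballI impI)
          fix i l :: nat assume "i \<noteq> l"
          then consider "Suc i \<le> l" | "Suc l \<le> i" by linarith
          then show "(residual n \<omega> i - residual n \<omega> (Suc i)) \<inter> (residual n \<omega> l - residual n \<omega> (Suc l)) = {}"
            using residual_antimono[of "Suc i" l n \<omega>] residual_antimono[of "Suc l" i n \<omega>] by cases blast+
        qed
      qed (use finT in auto)
      then show ?thesis using W_eq_residual[OF elim, of k] n by (simp add: tree_cost_def del: residual.simps)
    qed
    moreover have "c = (\<Sum>e\<in>U. t)" using U n by (simp add: c_def of_nat_diff)
    moreover have "ennreal (\<Sum>e\<in>U. t) \<le> ennreal (\<Sum>e\<in>U. cost \<omega> e) + Y \<omega>"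
    proof -
      have nn: "0 \<le> cost \<omega> e" if "e \<in> U" for e
        using generic_cost_pos[OF elim, of e] that by (simp add: U_def)
      have "ennreal (\<Sum>e\<in>U. t) = (\<Sum>e\<in>U. ennreal t)" using t by (intro sum_ennreal[symmetric])
      also have "\<dots> \<le> (\<Sum>e\<in>U. ennreal (cost \<omega> e) + ennreal (t - cost \<omega> e))"
      proof (rule sum_mono)
        fix e assume "e \<in> U"
        then show "ennreal t \<le> ennreal (cost \<omega> e) + ennreal (t - cost \<omega> e)"
          using nn[of e] by (cases "cost \<omega> e \<le> t") (auto simp: ennreal_plus[symmetric] ennreal_neg intro: ennreal_leI simp del: ennreal_plus)
      qed
      also have "\<dots> = ennreal (\<Sum>e\<in>U. cost \<omega> e) + (\<Sum>e\<in>U. ennreal (t - cost \<omega> e))"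
        using nn by (simp add: sum.distrib sum_ennreal)
      also have "\<dots> \<le> ennreal (\<Sum>e\<in>U. cost \<omega> e) + Y \<omega>"
        unfolding Y_def by (intro add_left_mono sum_le_suminf_edges U(1)) (auto simp: U_def)
      finally show ?thesis .
    qed
    ultimately show ?case by (simp add: ennreal_minus_le_iff add.commute)
  qed
  \<comment> \<open>\<open>b\<close> is both the claimed bound and the bound on the mean of
    \<open>Y\<close>. With the chosen \<open>t\<close>, \<open>c\<close> is exactly twice
    \<open>b\<close>, so one \<open>b\<close> remains after cancelling.\<close>
  define b where "b = real k ^ 2 * (real n - 1) / real n"
  have b: "0 \<le> b" "c = b + b"
    using n by (simp add: b_def) (simp add: b_def c_def t_def field_simps power2_eq_square)
  have "ennreal c = (\<integral>\<^sup>+\<omega>. ennreal c \<partial>?P)" by (simp add: P.emeasure_space_1)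
  \<comment> \<open>Adding \<open>Y\<close> back avoids subtracting integrals in
    \<open>ennreal\<close>; the finite \<open>b\<close> is cancelled only at the end.\<close>
  also have "\<dots> \<le> (\<integral>\<^sup>+\<omega>. (ennreal c - Y \<omega>) + Y \<omega> \<partial>?P)"
    by (intro nn_integral_mono) (metis ennreal_minus_le_iff order_refl add.commute)
  also have "\<dots> = (\<integral>\<^sup>+\<omega>. (ennreal c - Y \<omega>) \<partial>?P) + (\<integral>\<^sup>+\<omega>. Y \<omega> \<partial>?P)"
    by (intro nn_integral_add) auto
  also have "\<dots> \<le> EW n k + ennreal b"
    unfolding EW_def nn_integral_completion b_def by (intro add_mono nn_integral_mono_AE[OF dom] EY)
  finally have "ennreal b + ennreal b \<le> EW n k + ennreal b"
    unfolding b(2) ennreal_plus[OF b(1) b(1)] .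
  then have "ennreal b \<le> EW n k"
    by (simp add: ennreal_add_left_cancel_le add.commute)
  then show ?thesis by (simp add: b_def)
qed

theorem theorem3p1:
  fixes n k :: nat
  assumes "n \<ge> 2" and "k \<ge> 1"
  shows "ennreal (real k ^ 2 * (real n - 1) / real n) \<le> EW n k
       \<and> EW n k \<le> ennreal (real k * (real k + 1) * (real n - 1) / real n)
       \<and> real k * (real k + 1) * (real n - 1) / real n < real k ^ 2 + real k"
proof (intro conjI EW_ge EW_le assms(1))
  have "real k * (real k + 1) * (real n - 1) < real k * (real k + 1) * real n"
    using assms by (intro mult_strict_left_mono) auto
  then show "real k * (real k + 1) * (real n - 1) / real n < real k ^ 2 + real k"
    using assms by (simp add: divide_less_eq power2_eq_square algebra_simps)
qed

end
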